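(* Let $p$ be a prime number, let $s$ be a positive divisor of $p-1$, and let $\mathbb{K}$ be the unique subfield of $\mathbb{Q}(\zeta_p)$ with $[\mathbb{K}:\mathbb{Q}]=s$. Let $\tilde{\mathcal{M}}_p\subseteq\mathcal{O}_{\mathbb{K}}$ be the $\mathbb{Z}$-submodule defined in the context. Then the index of $\tilde{\mathcal{M}}_p$ in $\mathcal{O}_{\mathbb{K}}$ is given by $$[\mathcal{O}_{\mathbb{K}}:\tilde{\mathcal{M}}_p]=\begin{cases} 2p^{\frac{s+1}{2}} & \text{if } s\equiv 1\pmod 2,\\ 2p^{\frac{s+2}{2}} & \text{if } s\equiv 0\pmod 2.\end{cases}$$
   Context: Here $\zeta_p$ is a primitive $p$-th root of unity, $\mathbb{L}=\mathbb{Q}(\zeta_p)$, and $\mathcal{O}_{\mathbb{K}}$ is the ring of algebraic integers of $\mathbb{K}$. Let $u$ be an integer whose class generates $(\mathbb{Z}/p\mathbb{Z})^{\star}$, let $\sigma_u$ be the automorphism of $\mathbb{L}$ with $\sigma_u(\zeta_p)=\zeta_p^u$, let $\theta=\sigma_u|_{\mathbb{K}}$ (a generator of $\mathrm{Gal}(\mathbb{K}/\mathbb{Q})$), and let $t=\mathrm{Tr}_{\mathbb{L}/\mathbb{K}}(\zeta_p)$. The map $(a_0,\ldots,a_{s-1})\mapsto\sum_{i=0}^{s-1}a_i\theta^i(t)$ is an isomorphism of $\mathbb{Z}$-modules $\mathbb{Z}^s\to\mathcal{O}_{\mathbb{K}}$, and through it elements ${\bf x}\in\mathcal{O}_{\mathbb{K}}$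 are identified with their coordinate vectors ${\bf x}=(a_0,\ldots,a_{s-1})\in\mathbb{Z}^s$. Let $\beta\in\mathbb{Z}$ be a primitive root modulo $p$ (of multiplicative order $p-1$ modulo $p$), and put $\alpha=\beta^{(p-1)/s}$. For $i=0,1,\ldots,s-1$ let $\mu_i=(1,\alpha^i,\alpha^{2i},\ldots,\alpha^{(s-1)i})\in\mathbb{Z}^s$, and let $\cdot$ denote the usual dot product on $\mathbb{Z}^s$. Define: if $s$ is odd, $\mathcal{M}_p=\{{\bf x}\in\mathcal{O}_{\mathbb{K}}:{\bf x}\cdot\mu_i\equiv 0\pmod p\text{ for all } i=0,1,\ldots,\frac{s-1}{2}\}$; if $s$ is even, $\mathcal{M}_p=\{{\bf x}\in\mathcal{O}_{\mathbb{K}}:{\bf x}\cdot\mu_i\equiv 0\pmod p\text{ for all } i=0,1,\ldots,\frac{s}{2}\}$. In both cases, $\tilde{\mathcal{M}}_p=\{{\bf x}=(a_0,\ldots,a_{s-1})\in\mathcal{M}_p:\sum_{i=0}^{s-1}a_i\equiv 0\pmod 2\}$.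
   Formalization: The prime p is assumed to be odd: for p = 2 (so s = 1, K = Q) the condition modulo p and the parity condition coincide, so the index is 2 and not 4 as the formula claims. *)

theory Defs
  imports
    "HOL-Algebra.Algebra"
    "HOL-Algebra.Algebraic_Closure_Type"
    "HOL-Number_Theory.Number_Theory"
begin

abbreviation complex_ring :: "complex ring" where
  "complex_ring \<equiv> ring_of_type_algebra"

abbreviation complex_subring :: "complex set \<Rightarrow> complex ring" where
  "complex_subring A \<equiv> complex_ring\<lparr>carrier := A\<rparr>"

definition primitive_root_of_unity :: "nat \<Rightarrow> complex \<Rightarrow> bool" where
  "primitive_root_of_unity n \<zeta> \<longleftrightarrow> 0 < n \<and> \<zeta> ^ n = 1 \<and> (\<forall>k. 0 < k \<and> k < n \<longrightarrow> \<zeta> ^ k \<noteq> 1)"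

definition rat_adjoin :: "complex \<Rightarrow> complex set" where
  "rat_adjoin \<zeta> = generate_field complex_ring (insert \<zeta> \<rat>)"

definition ring_of_integers :: "complex set \<Rightarrow> complex set" where
  "ring_of_integers K = {x \<in> K. algebraic_int x}"

(* Requiring extensionality makes an embedding determined by its values on L,
   so that each embedding is counted once in the trace. *)
definition embeddings :: "complex set \<Rightarrow> complex set \<Rightarrow> (complex \<Rightarrow> complex) set" where
  "embeddings K L = {\<tau> \<in> ring_hom (complex_subring L) complex_ring \<inter> extensional L. \<forall>x\<in>K. \<tau> x = x}"

definition field_trace :: "complex set \<Rightarrow> complex set \<Rightarrow> complex \<Rightarrow> complex" where
  "field_trace K L x = (\<Sum>\<tau>\<in>embeddings K L. \<tau> x)"

definition generates_units_mod :: "nat \<Rightarrow> int \<Rightarrow> bool" where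
  "generates_units_mod p u \<longleftrightarrow>
     u mod int p \<in> carrier (units_of (residue_ring (int p))) \<and>
     generate (units_of (residue_ring (int p))) {u mod int p} = carrier (units_of (residue_ring (int p)))"

definition int_vectors :: "nat \<Rightarrow> (nat \<Rightarrow> int) set" where
  "int_vectors s = {..<s} \<rightarrow>\<^sub>E UNIV"

definition int_dot :: "nat \<Rightarrow> (nat \<Rightarrow> int) \<Rightarrow> (nat \<Rightarrow> int) \<Rightarrow> int" where
  "int_dot s a b = (\<Sum>j<s. a j * b j)"

definition from_coords :: "nat \<Rightarrow> (complex \<Rightarrow> complex) \<Rightarrow> complex \<Rightarrow> (nat \<Rightarrow> int) \<Rightarrow> complex" where
  "from_coords s \<theta> t a = (\<Sum>i<s. of_int (a i) * (\<theta> ^^ i) t)"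

(* Meaningful where from_coords s \<theta> t is injective on int_vectors s; this holds for
   the \<theta> and t of a subfield of degree s of the p-th cyclotomic field, where
   from_coords s \<theta> t is a bijection from int_vectors s onto the ring of integers. *)
definition coords :: "nat \<Rightarrow> (complex \<Rightarrow> complex) \<Rightarrow> complex \<Rightarrow> complex \<Rightarrow> (nat \<Rightarrow> int)" where
  "coords s \<theta> t = the_inv_into (int_vectors s) (from_coords s \<theta> t)"

definition mu_vec :: "int \<Rightarrow> nat \<Rightarrow> (nat \<Rightarrow> int)" where
  "mu_vec \<alpha> i = (\<lambda>j. \<alpha> ^ (j * i))"

definition M_module ::
  "nat \<Rightarrow> nat \<Rightarrow> complex set \<Rightarrow> (complex \<Rightarrow> complex) \<Rightarrow> complex \<Rightarrow> int \<Rightarrow> complex set" where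
  "M_module p s K \<theta> t \<alpha> = {x \<in> ring_of_integers K.
     \<forall>i \<in> {0..(if odd s then (s - 1) div 2 else s div 2)}.
       [int_dot s (coords s \<theta> t x) (mu_vec \<alpha> i) = 0] (mod int p)}"

definition M_tilde ::
  "nat \<Rightarrow> nat \<Rightarrow> complex set \<Rightarrow> (complex \<Rightarrow> complex) \<Rightarrow> complex \<Rightarrow> int \<Rightarrow> complex set" where
  "M_tilde p s K \<theta> t \<alpha> = {x \<in> M_module p s K \<theta> t \<alpha>.
     [(\<Sum>i<s. coords s \<theta> t x i) = 0] (mod 2)}"

(* Number of cosets of N in the additive group A; the value is 0 if it is infinite. *)
definition additive_index :: "complex set \<Rightarrow> complex set \<Rightarrow> nat" where
  "additive_index A N = card (a_rcosets\<^bsub>complex_subring A\<^esub> N)"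

end

theory Submission
  imports Defs
begin

text \<open>
  Write \<open>n = p - 1\<close>, let \<open>g\<close> be a generator modulo \<open>p\<close> with \<open>\<sigma> \<zeta> = \<zeta>\<^sup>g\<close>, and put
  \<open>e\<^sub>i = \<sigma>\<^sup>i \<zeta>\<close>. The trace form \<open>x \<mapsto> \<Sum>k<n. \<sigma>\<^sup>k x\<close> recovers coefficients: it maps
  \<open>x (1/e\<^sub>j - 1)\<close> to \<open>p\<close> times the \<open>j\<close>-th coefficient of \<open>x\<close>. Hence the \<open>e\<^sub>i\<close> are
  a rational basis of \<open>L\<close>, and the coefficients of an algebraic integer lie in \<open>(1/p)\<int>\<close>;
  expanding in powers of \<open>1 - \<zeta>\<close>, whose \<open>n\<close>-th power divides \<open>p\<close>, removes the denominator.

  If \<open>d\<close> is the least positive exponent such that \<open>\<sigma>\<^sup>d\<close> fixes \<open>K\<close>, then \<open>\<sigma>\<^sup>0, \<dots>, \<sigma>\<^sup>d\<^sup>-\<^sup>1\<close> are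
  distinct on \<open>K\<close>, so \<open>d \<le> s\<close> by Dedekind, while \<open>K\<close> lies in the fixed field of \<open>\<sigma>\<^sup>d\<close>, which
  is spanned by the \<open>d\<close> Gaussian periods. Therefore \<open>d = s\<close>, and the integers of \<open>K\<close> are the
  integral combinations of the periods, which are the conjugates \<open>\<theta>\<^sup>i(t)\<close>.

  In these coordinates the defining congruences of the module are the values at the first few
  powers of \<open>\<alpha>\<close>, an element of order \<open>s\<close> modulo \<open>p\<close>, together with a parity condition. By
  interpolation modulo \<open>p\<close> all these residues can be prescribed independently.
\<close>

section \<open>The field of complex numbers as a ring structure\<close>

lemma complex_ring_simps [simp]:
  "carrier complex_ring = UNIV" "monoid.mult complex_ring x y = x * y"
  "monoid.one complex_ring = 1" "ring.zero complex_ring = 0" "ring.add complex_ring x y = x + y"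
  by (simp_all add: ring_of_type_algebra_def)

interpretation complex_ring: cring complex_ring
  by (rule cring_from_type_algebra)

lemma field_complex_ring: "field complex_ring"
  by (rule field_from_type_algebra)

lemma complex_ring_uminus [simp]: "\<ominus>\<^bsub>complex_ring\<^esub> x = - x"
  by (rule complex_ring.minus_equality) auto

lemma complex_ring_inv [simp]: "x \<noteq> 0 \<Longrightarrow> inv\<^bsub>complex_ring\<^esub> x = inverse x"
  by (rule complex_ring.comm_inv_char) auto

lemma subfield_complexD:
  assumes "subfield K complex_ring"
  shows "\<rat> \<subseteq> K"
    and "x \<in> K \<Longrightarrow> y \<in> K \<Longrightarrow> x + y \<in> K"
    and "x \<in> K \<Longrightarrow> y \<in> K \<Longrightarrow> x * y \<in> K"
    and "x \<in> K \<Longrightarrow> - x \<in> K"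
    and "x \<in> K \<Longrightarrow> inverse x \<in> K"
proof -
  note sub = ring.subfield_m_inv[OF complex_ring.ring_axioms assms] subringE[OF subfieldE(1)[OF assms]]
  show add: "x \<in> K \<Longrightarrow> y \<in> K \<Longrightarrow> x + y \<in> K" for x y
    using sub(10) by simp
  show mult: "x \<in> K \<Longrightarrow> y \<in> K \<Longrightarrow> x * y \<in> K" for x y
    using sub(9) by simp
  show um: "x \<in> K \<Longrightarrow> - x \<in> K" for x
    using sub(8) by simp
  have zero: "0 \<in> K" and one: "1 \<in> K"
    using sub(5,6) by simp_all
  show inv: "x \<in> K \<Longrightarrow> inverse x \<in> K" for x
    using sub(1)[of x] zero by (cases "x = 0") auto
  have nat: "of_nat n \<in> K" for n
    by (induction n) (auto intro: zero one add)
  have int: "of_int n \<in> K" for n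
    using nat um by (cases n rule: int_cases2) (auto simp del: of_nat_Suc)
  show "\<rat> \<subseteq> K"
  proof
    fix x :: complex assume "x \<in> \<rat>"
    then obtain a b where "x = of_int a / of_int b" by (auto elim: Rats_cases')
    then show "x \<in> K"
      using int mult inv by (simp add: divide_inverse)
  qed
qed

lemma subfield_rat_adjoin: "subfield (rat_adjoin \<zeta>) complex_ring"
  unfolding rat_adjoin_def by (rule field.generate_field_is_subfield[OF field_complex_ring]) simp

lemma rat_adjoin_mem: "\<zeta> \<in> rat_adjoin \<zeta>"
  unfolding rat_adjoin_def by (rule generate_field.incl) simp

section \<open>The normal basis of the cyclotomic field\<close>

text \<open>Moving the window by one drops \<open>f i\<close> and gains \<open>f (i + n)\<close>,
  which is the same value.\<close>

lemma sum_periodic_shift: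
  fixes f :: "nat \<Rightarrow> 'a::ab_group_add"
  assumes "\<And>k. f (k + n) = f k"
  shows "(\<Sum>k<n. f (i + k)) = (\<Sum>k<n. f k)"
proof (induction i)
  case (Suc i)
  have "(\<Sum>k<n. f (Suc i + k)) + f i = (\<Sum>k<Suc n. f (i + k))"
    by (subst sum.lessThan_Suc_shift) (simp add: algebra_simps)
  also have "\<dots> = (\<Sum>k<n. f (i + k)) + f i"
    using assms[of i] by simp
  finally show ?case using Suc by simp
qed simp

text \<open>Replaces the possibly negative \<open>u\<close> by a natural number, so that powers of
  roots of unity have natural exponents. In a finite group, the subgroup generated by an element
  consists of its natural powers.\<close>

lemma generates_units_modD:
  assumes "Factorial_Ring.prime p" "generates_units_mod p u"
  obtains g where "[u = int g] (mod int p)" "\<And>a. \<not> p dvd a \<Longrightarrow> \<exists>i. [g ^ i = a] (mod p)"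
proof -
  interpret R: residues_prime p "residue_ring (int p)"
    using assms(1) by unfold_locales auto
  let ?G = "units_of (residue_ring (int p))"
  interpret G: group ?G by (rule R.units_group)
  have p: "p > 1" using assms(1) prime_gt_1_nat by blast
  define g where "g = nat (u mod int p)"
  have g: "int g = u mod int p"
    using p by (simp add: g_def)
  have fin: "finite (carrier ?G)" by (simp add: units_of_carrier)
  have mem: "u mod int p \<in> carrier ?G" and gen: "generate ?G {u mod int p} = carrier ?G"
    using assms(2) by (auto simp: generates_units_mod_def)
  have "\<exists>i. [g ^ i = a] (mod p)" if "\<not> p dvd a" for a
  proof -
    have "coprime (int a) (int p)"
      using that assms(1) prime_imp_coprime_nat[of p a] by (simp add: coprime_commute)
    then have "int a mod int p \<in> Units (residue_ring (int p))"
      using R.mod_in_res_units[of "int a"] p by simp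
    then have "int a mod int p \<in> generate ?G {u mod int p}"
      using gen by (simp add: units_of_carrier)
    then obtain i :: nat where "int a mod int p = (u mod int p) [^]\<^bsub>?G\<^esub> i"
      using G.generate_pow_on_finite_carrier[OF fin mem] by auto
    also have "\<dots> = (u mod int p) [^]\<^bsub>residue_ring (int p)\<^esub> i"
      using mem by (intro R.units_of_pow) (simp add: units_of_carrier)
    also have "\<dots> = (u mod int p) ^ i mod int p"
      using R.pow_cong[of "u mod int p" i] by simp
    finally have "int a mod int p = int (g ^ i) mod int p"
      by (simp add: g)
    then have "a mod p = g ^ i mod p"
      by (metis of_nat_eq_iff of_nat_mod)
    then show ?thesis by (auto simp: cong_def)
  qed
  moreover have "[u = int g] (mod int p)" by (simp add: g cong_def)
  ultimately show ?thesis using that by blast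
qed

section \<open>The cyclotomic field with a generating automorphism\<close>

locale cyclotomic_automorphism =
  fixes p g :: nat and \<zeta> :: complex and \<sigma> :: "complex \<Rightarrow> complex" and L :: "complex set"
  defines "L \<equiv> rat_adjoin \<zeta>"
  assumes prime: "Factorial_Ring.prime p" and odd: "odd p"
    and root: "primitive_root_of_unity p \<zeta>"
    and generator: "\<And>a. \<not> p dvd a \<Longrightarrow> \<exists>i. [g ^ i = a] (mod p)"
    and \<sigma>_mem: "\<And>x. x \<in> L \<Longrightarrow> \<sigma> x \<in> L"
    and \<sigma>_add: "\<And>x y. x \<in> L \<Longrightarrow> y \<in> L \<Longrightarrow> \<sigma> (x + y) = \<sigma> x + \<sigma> y"
    and \<sigma>_mult: "\<And>x y. x \<in> L \<Longrightarrow> y \<in> L \<Longrightarrow> \<sigma> (x * y) = \<sigma> x * \<sigma> y"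
    and \<sigma>_one: "\<sigma> 1 = 1"
    and inj_\<sigma>: "inj_on \<sigma> L"
    and \<sigma>_root: "\<sigma> \<zeta> = \<zeta> ^ g"
begin

definition n :: nat where "n = p - 1"

definition e :: "nat \<Rightarrow> complex" where "e i = \<zeta> ^ (g ^ i)"

lemmas subfield_L = subfield_rat_adjoin[of \<zeta>, folded L_def]
lemmas Rats_subset_L = subfield_complexD(1)[OF subfield_L]
lemmas L_closed = subfield_complexD(2-)[OF subfield_L]

lemma Rats_L: "x \<in> \<rat> \<Longrightarrow> x \<in> L"
  using Rats_subset_L by blast

lemma root_L: "\<zeta> \<in> L"
  unfolding L_def by (rule rat_adjoin_mem)

lemma p_gt_2: "p > 2"
  using prime odd prime_ge_2_nat[of p] by (cases "p = 2") auto

lemma n_pos: "n > 0" and Suc_n: "Suc n = p"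
  using p_gt_2 by (auto simp: n_def)

lemma diff_L: "x \<in> L \<Longrightarrow> y \<in> L \<Longrightarrow> x - y \<in> L"
  using L_closed(1)[of x "- y"] L_closed(3) by simp

lemma sum_L: "(\<And>i. i \<in> A \<Longrightarrow> f i \<in> L) \<Longrightarrow> (\<Sum>i\<in>A. f i) \<in> L"
  by (induction A rule: infinite_finite_induct) (auto intro: L_closed Rats_L)

lemma prod_L: "(\<And>i. i \<in> A \<Longrightarrow> f i \<in> L) \<Longrightarrow> (\<Prod>i\<in>A. f i) \<in> L"
  by (induction A rule: infinite_finite_induct) (auto intro: L_closed Rats_L)

lemma power_L: "x \<in> L \<Longrightarrow> x ^ k \<in> L"
  by (induction k) (auto intro: L_closed Rats_L)

lemma root_pow_p: "\<zeta> ^ p = 1" and root_pow_ne: "0 < k \<Longrightarrow> k < p \<Longrightarrow> \<zeta> ^ k \<noteq> 1"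
  using root by (auto simp: primitive_root_of_unity_def)

lemma root_nonzero [simp]: "\<zeta> \<noteq> 0"
  using root_pow_p p_gt_2 by (auto simp: power_0_left)

lemma root_pow_mod: "\<zeta> ^ (a mod p) = \<zeta> ^ a"
proof -
  have "\<zeta> ^ a = \<zeta> ^ (p * (a div p) + a mod p)" by simp
  also have "\<dots> = \<zeta> ^ (a mod p)"
    by (simp only: power_add power_mult root_pow_p) simp
  finally show ?thesis by simp
qed

lemma root_pow_eq_iff: "\<zeta> ^ a = \<zeta> ^ b \<longleftrightarrow> [a = b] (mod p)"
proof
  assume "[a = b] (mod p)"
  then show "\<zeta> ^ a = \<zeta> ^ b"
    by (metis cong_def root_pow_mod)
next
  have *: "[a = b] (mod p)" if le: "a \<le> b" and eq: "\<zeta> ^ a = \<zeta> ^ b" for a b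
  proof -
    have "\<zeta> ^ a * \<zeta> ^ (b - a) = \<zeta> ^ a * 1"
      using le eq by (metis le_add_diff_inverse mult_1_right power_add)
    then have "\<zeta> ^ ((b - a) mod p) = 1"
      by (simp add: root_pow_mod)
    then have "(b - a) mod p = 0"
      using root_pow_ne[of "(b - a) mod p"] p_gt_2 by fastforce
    then show ?thesis
      using le by (metis cong_altdef_nat cong_sym dvd_eq_mod_eq_0)
  qed
  assume "\<zeta> ^ a = \<zeta> ^ b"
  then show "[a = b] (mod p)"
    using *[of a b] *[of b a] by (metis cong_sym linear)
qed

lemma sum_root_pow: "(\<Sum>j<p. \<zeta> ^ j) = 0"
proof -
  have "\<zeta> \<noteq> 1" using root_pow_ne[of 1] p_gt_2 by simp
  moreover have "(1 - \<zeta>) * (\<Sum>j<p. \<zeta> ^ j) = 0"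
    using root_pow_p by (simp add: one_diff_power_eq[symmetric])
  ultimately show ?thesis by simp
qed

text \<open>The powers of a multiple of \<open>p\<close> are congruent to 0 or 1, so none of them
  could reach the residue 2.\<close>

lemma g_coprime: "coprime g p"
proof -
  obtain i where i: "[g ^ i = 2] (mod p)"
    using generator[of 2] p_gt_2 dvd_imp_le[of p 2] by auto
  show ?thesis
  proof (rule ccontr)
    assume "\<not> ?thesis"
    then have "p dvd g" using prime by (metis coprime_commute prime_imp_coprime)
    have "i \<noteq> 0" using i p_gt_2 by (intro notI) (auto simp: cong_def)
    then have "p dvd g ^ i" using \<open>p dvd g\<close> by (meson dvd_power dvd_trans neq0_conv)
    then show False using i p_gt_2 by (auto simp: cong_def mod_eq_0_iff_dvd dest: dvd_imp_le)
  qed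
qed

lemma not_dvd_g_pow: "\<not> p dvd g ^ i"
  using g_coprime prime by (metis coprime_common_divisor dvd_refl not_prime_unit prime_dvd_power_nat)

lemma g_pow_n: "[g ^ n = 1] (mod p)"
  using fermat_theorem[OF prime] not_dvd_g_pow[of 1] by (simp add: n_def)

lemma g_pow_period: "[g ^ (i + n) = g ^ i] (mod p)"
  using cong_mult[OF cong_refl g_pow_n, of "g ^ i"] by (simp add: power_add)

lemma g_pow_mod_n: "[g ^ (i mod n) = g ^ i] (mod p)"
proof -
  have "[g ^ (n * (i div n) + i mod n) = 1 ^ (i div n) * g ^ (i mod n)] (mod p)"
    unfolding power_add power_mult by (intro cong_mult cong_pow g_pow_n cong_refl)
  then show ?thesis by (simp add: cong_sym)
qed

text \<open>The generator property gives surjectivity; both sides have \<open>p - 1\<close>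
  elements, so injectivity follows.\<close>

lemma g_pow_bij: "bij_betw (\<lambda>i. g ^ i mod p) {..<n} {1..<p}"
proof -
  let ?f = "\<lambda>i. g ^ i mod p"
  have "?f ` {..<n} = {1..<p}"
  proof
    show "?f ` {..<n} \<subseteq> {1..<p}"
      using not_dvd_g_pow p_gt_2 by (auto simp: Suc_le_eq dvd_eq_mod_eq_0)
    show "{1..<p} \<subseteq> ?f ` {..<n}"
    proof
      fix a assume a: "a \<in> {1..<p}"
      then obtain i where "[g ^ i = a] (mod p)"
        using generator[of a] dvd_imp_le[of p a] by auto
      then have "?f (i mod n) = a"
        using a g_pow_mod_n[of i] by (simp add: cong_def)
      then show "a \<in> ?f ` {..<n}" using n_pos by force
    qed
  qed
  moreover from this have "inj_on ?f {..<n}"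
    by (intro eq_card_imp_inj_on) (auto simp: n_def)
  ultimately show ?thesis by (simp add: bij_betw_def)
qed

lemma e_L: "e i \<in> L"
  by (simp add: e_def power_L root_L)

lemma e_0: "e 0 = \<zeta>"
  by (simp add: e_def)

lemma e_nonzero [simp]: "e i \<noteq> 0"
  by (simp add: e_def)

lemma e_period: "e (i + n) = e i"
  unfolding e_def root_pow_eq_iff by (rule g_pow_period)

lemma e_mod: "e (i mod n) = e i"
  unfolding e_def root_pow_eq_iff by (rule g_pow_mod_n)

lemma e_inj: "i < n \<Longrightarrow> j < n \<Longrightarrow> e i = e j \<longleftrightarrow> i = j"
  using g_pow_bij by (auto simp: e_def root_pow_eq_iff cong_def bij_betw_def dest: inj_onD)

lemma root_pow_eq_e:
  assumes "\<not> p dvd a" obtains i where "i < n" "\<zeta> ^ a = e i"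
proof -
  obtain i where "[g ^ i = a] (mod p)" using generator assms by blast
  then have "\<zeta> ^ a = e i" by (simp add: e_def root_pow_eq_iff cong_sym)
  then show ?thesis using that[of "i mod n"] n_pos by (simp add: e_mod)
qed

lemma sum_over_e: "(\<Sum>i<n. h (e i)) = (\<Sum>a\<in>{1..<p}. h (\<zeta> ^ a))"
  using sum.reindex_bij_betw[OF g_pow_bij, of "\<lambda>a. h (\<zeta> ^ a)"]
  by (simp add: root_pow_mod e_def)

lemma sum_e: "(\<Sum>i<n. e i) = -1"
proof -
  have "(\<Sum>j<p. \<zeta> ^ j) = 1 + (\<Sum>a\<in>{1..<p}. \<zeta> ^ a)"
    using sum.atLeast_Suc_lessThan[of 0 p "\<lambda>j. \<zeta> ^ j"] p_gt_2
    by (simp add: lessThan_atLeast0)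
  then show ?thesis
    using sum_over_e[of "\<lambda>x. x"] sum_root_pow by (simp add: add_eq_0_iff)
qed

section \<open>Iterates of the automorphism\<close>

lemma \<sigma>_zero: "\<sigma> 0 = 0"
  using \<sigma>_add[of 0 0] Rats_L by simp

lemma \<sigma>_Rats: "x \<in> \<rat> \<Longrightarrow> \<sigma> x = x"
proof -
  have neg: "\<sigma> (- y) = - \<sigma> y" if "y \<in> L" for y
    using \<sigma>_add[of y "- y"] that by (simp add: \<sigma>_zero L_closed eq_neg_iff_add_eq_0 add.commute)
  have nat: "\<sigma> (of_nat k) = of_nat k" for k
    by (induction k) (auto simp: \<sigma>_zero \<sigma>_one \<sigma>_add Rats_L)
  have int: "\<sigma> (of_int k) = of_int k" for k
    by (cases k rule: int_cases2) (auto simp: nat neg Rats_L)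
  assume "x \<in> \<rat>"
  then obtain a b where ab: "b > 0" "x = of_int a / of_int b" by (auto elim: Rats_cases')
  have "\<sigma> (x * of_int b) = \<sigma> x * of_int b"
    using \<open>x \<in> \<rat>\<close> by (simp add: \<sigma>_mult Rats_L int)
  then show "\<sigma> x = x"
    using ab(1) by (simp add: ab(2) int nonzero_eq_divide_eq)
qed

abbreviation \<sigma>\<^sub>k :: "nat \<Rightarrow> complex \<Rightarrow> complex" where "\<sigma>\<^sub>k k \<equiv> \<sigma> ^^ k"

lemma pow_mem: "x \<in> L \<Longrightarrow> \<sigma>\<^sub>k k x \<in> L"
  by (induction k) (auto simp: \<sigma>_mem)

lemma pow_add: "x \<in> L \<Longrightarrow> y \<in> L \<Longrightarrow> \<sigma>\<^sub>k k (x + y) = \<sigma>\<^sub>k k x + \<sigma>\<^sub>k k y"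
  by (induction k) (auto simp: \<sigma>_add pow_mem)

lemma pow_diff:
  assumes "x \<in> L" "y \<in> L"
  shows "\<sigma>\<^sub>k k (x - y) = \<sigma>\<^sub>k k x - \<sigma>\<^sub>k k y"
  using pow_add[of "x - y" y k] diff_L[OF assms] assms by simp

lemma pow_mult: "x \<in> L \<Longrightarrow> y \<in> L \<Longrightarrow> \<sigma>\<^sub>k k (x * y) = \<sigma>\<^sub>k k x * \<sigma>\<^sub>k k y"
  by (induction k) (auto simp: \<sigma>_mult pow_mem)

lemma pow_Rats: "q \<in> \<rat> \<Longrightarrow> \<sigma>\<^sub>k k q = q"
  by (induction k) (auto simp: \<sigma>_Rats)

lemma pow_sum: "(\<And>i. i \<in> A \<Longrightarrow> f i \<in> L) \<Longrightarrow> \<sigma>\<^sub>k k (\<Sum>i\<in>A. f i) = (\<Sum>i\<in>A. \<sigma>\<^sub>k k (f i))"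
  by (induction A rule: infinite_finite_induct) (auto simp: pow_add pow_Rats sum_L)

lemma pow_prod: "(\<And>i. i \<in> A \<Longrightarrow> f i \<in> L) \<Longrightarrow> \<sigma>\<^sub>k k (\<Prod>i\<in>A. f i) = (\<Prod>i\<in>A. \<sigma>\<^sub>k k (f i))"
  by (induction A rule: infinite_finite_induct) (auto simp: pow_mult pow_Rats prod_L)

lemma pow_power: "x \<in> L \<Longrightarrow> \<sigma>\<^sub>k k (x ^ m) = \<sigma>\<^sub>k k x ^ m"
  using pow_prod[of "{..<m}" "\<lambda>_. x"] by simp

lemma pow_inj: "x \<in> L \<Longrightarrow> y \<in> L \<Longrightarrow> \<sigma>\<^sub>k k x = \<sigma>\<^sub>k k y \<Longrightarrow> x = y"
  by (induction k) (auto simp: pow_mem dest: inj_onD[OF inj_\<sigma>])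

lemma pow_root: "\<sigma>\<^sub>k k \<zeta> = \<zeta> ^ (g ^ k)"
proof (induction k)
  case (Suc k)
  then have "\<sigma>\<^sub>k (Suc k) \<zeta> = \<sigma>\<^sub>k 1 \<zeta> ^ (g ^ k)"
    using pow_power[OF root_L, of 1] by simp
  then show ?case by (simp add: \<sigma>_root power_mult mult.commute)
qed simp

lemma pow_root_pow: "\<sigma>\<^sub>k k (\<zeta> ^ m) = \<zeta> ^ (m * g ^ k)"
  by (simp add: pow_power root_L pow_root flip: power_mult) (simp add: mult.commute)

lemma pow_e: "\<sigma>\<^sub>k k (e i) = e (i + k)"
  by (simp add: e_def pow_root_pow power_add)

section \<open>The trace form and its extraction of coefficients\<close>

text \<open>A power of \<zeta> other than 1 is some \<open>e i\<close>, and its iterates run once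
  through all \<open>e k\<close>, whose sum is -1. Otherwise all \<open>n\<close> summands are
  1.\<close>

lemma trace_root_pow: "(\<Sum>k<n. \<sigma>\<^sub>k k (\<zeta> ^ m)) = (if p dvd m then of_nat p - 1 else -1)"
proof (cases "p dvd m")
  case True
  then have "\<zeta> ^ (m * g ^ k) = 1" for k
    using root_pow_eq_iff[of "m * g ^ k" 0] by (simp add: cong_0_iff)
  then show ?thesis using True p_gt_2 by (simp add: pow_root_pow n_def of_nat_diff)
next
  case False
  then obtain i where "\<zeta> ^ m = e i" using root_pow_eq_e by blast
  then show ?thesis
    using False sum_periodic_shift[of e n i] by (simp add: pow_e e_period sum_e)
qed

text \<open>The factor \<open>e j ^ n\<close> is the inverse of \<open>e j\<close>.\<close>

lemma trace_coefficient:
  assumes c: "\<And>i. i < n \<Longrightarrow> c i \<in> \<rat>" and j: "j < n"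
  defines "x \<equiv> \<Sum>i<n. c i * e i"
  shows "(\<Sum>k<n. \<sigma>\<^sub>k k (x * (e j ^ n - 1))) = of_nat p * c j"
proof -
  have [simp]: "c i \<in> L" if "i < n" for i using c[OF that] by (rule Rats_L)
  have *: "(\<Sum>k<n. \<sigma>\<^sub>k k (e i * (e j ^ n - 1))) = (if i = j then of_nat p else 0)"
    if i: "i < n" for i
  proof -
    let ?m = "g ^ i + g ^ j * n"
    \<comment> \<open>Adding \<open>g ^ j\<close> turns the multiple \<open>n\<close> of
      \<open>g ^ j\<close> into the multiple \<open>p\<close>, which vanishes.\<close>
    have "[g ^ i + g ^ j * n = 0] (mod p) \<longleftrightarrow> [g ^ i + g ^ j * n + g ^ j = 0 + g ^ j] (mod p)"
      by (metis cong_add_rcancel_nat)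
    also have "g ^ i + g ^ j * n + g ^ j = g ^ i + g ^ j * p"
      using Suc_n by (metis add.assoc add.commute mult_Suc_right)
    also have "[g ^ i + g ^ j * p = 0 + g ^ j] (mod p) \<longleftrightarrow> [g ^ i = g ^ j] (mod p)"
      by (simp add: cong_def)
    also have "\<dots> \<longleftrightarrow> i = j"
      using e_inj[OF i j] by (simp add: e_def root_pow_eq_iff)
    finally have dvd: "p dvd ?m \<longleftrightarrow> i = j" by (simp add: cong_0_iff)
    have "\<sigma>\<^sub>k k (e i * (e j ^ n - 1)) = \<sigma>\<^sub>k k (\<zeta> ^ ?m) - \<sigma>\<^sub>k k (\<zeta> ^ (g ^ i))" for k
    proof -
      have "e i * (e j ^ n - 1) = \<zeta> ^ ?m - \<zeta> ^ (g ^ i)"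
        by (simp only: e_def power_add power_mult) (simp add: algebra_simps)
      then show ?thesis
        by (simp add: pow_diff power_L root_L)
    qed
    then have "(\<Sum>k<n. \<sigma>\<^sub>k k (e i * (e j ^ n - 1))) =
        (\<Sum>k<n. \<sigma>\<^sub>k k (\<zeta> ^ ?m)) - (\<Sum>k<n. \<sigma>\<^sub>k k (\<zeta> ^ (g ^ i)))"
      by (simp add: sum_subtractf)
    \<comment> \<open>The second trace is always -1; the first is \<open>p - 1\<close> if
      \<open>i = j\<close> and -1 otherwise. The difference is \<open>p\<close> or 0.\<close>
    then show ?thesis
      unfolding trace_root_pow dvd by (simp add: not_dvd_g_pow)
  qed
  have mem: "e i * (e j ^ n - 1) \<in> L" for i
    by (auto intro!: L_closed(2) diff_L e_L power_L Rats_L[OF Rats_1])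
  have "x * (e j ^ n - 1) = (\<Sum>i<n. c i * (e i * (e j ^ n - 1)))"
    by (simp add: x_def sum_distrib_right mult.assoc)
  then have "\<sigma>\<^sub>k k (x * (e j ^ n - 1)) = (\<Sum>i<n. c i * \<sigma>\<^sub>k k (e i * (e j ^ n - 1)))" for k
    using pow_sum[of "{..<n}" "\<lambda>i. c i * (e i * (e j ^ n - 1))" k]
    by (simp add: L_closed(2) mem pow_mult[OF _ mem] pow_Rats c)
  then have "(\<Sum>k<n. \<sigma>\<^sub>k k (x * (e j ^ n - 1))) =
      (\<Sum>i<n. c i * (\<Sum>k<n. \<sigma>\<^sub>k k (e i * (e j ^ n - 1))))"
    by (simp only: sum_distrib_left) (rule sum.swap)
  also have "\<dots> = (\<Sum>i<n. if i = j then of_nat p * c i else 0)"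
    by (intro sum.cong) (auto simp: *)
  also have "\<dots> = of_nat p * c j" using j by simp
  finally show ?thesis .
qed

lemma e_independent:
  assumes "\<And>i. i < n \<Longrightarrow> c i \<in> \<rat>" "\<And>i. i < n \<Longrightarrow> d i \<in> \<rat>"
    and eq: "(\<Sum>i<n. c i * e i) = (\<Sum>i<n. d i * e i)" and "j < n"
  shows "c j = d j"
proof -
  have "of_nat p * c j = of_nat p * d j"
    using trace_coefficient[of c, OF assms(1) assms(4)] trace_coefficient[of d, OF assms(2) assms(4)]
    by (simp only: eq)
  then show ?thesis using p_gt_2 by simp
qed

section \<open>Integral and rational combinations of the conjugates\<close>

text \<open>Periodic coefficients let index shifts be written without reduction modulo \<open>n\<close>.\<close>

definition W :: "complex set \<Rightarrow> complex set" where
  "W S = {\<Sum>i<n. c i * e i | c. (\<forall>i. c i \<in> S) \<and> (\<forall>i. c (i + n) = c i)}"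

lemma W_I:
  assumes "\<And>i. i < n \<Longrightarrow> c i \<in> S" and "x = (\<Sum>i<n. c i * e i)"
  shows "x \<in> W S"
  unfolding W_def mem_Collect_eq
  using assms n_pos by (intro exI[of _ "\<lambda>i. c (i mod n)"]) auto

lemma W_E:
  assumes "x \<in> W S"
  obtains c where "\<And>i. c i \<in> S" "\<And>i. c (i + n) = c i" "x = (\<Sum>i<n. c i * e i)"
  using assms by (auto simp: W_def)

text \<open>One argument serves both coefficient rings: \<open>W \<rat>\<close> will be
  \<open>L\<close>, and \<open>W \<int>\<close> its ring of integers.\<close>

context
  fixes S :: "complex set"
  assumes S: "S = \<int> \<or> S = \<rat>"
begin

lemma S_closed:
  "0 \<in> S" "1 \<in> S" "x \<in> S \<Longrightarrow> y \<in> S \<Longrightarrow> x + y \<in> S" "x \<in> S \<Longrightarrow> y \<in> S \<Longrightarrow> x * y \<in> S"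
  "x \<in> S \<Longrightarrow> - x \<in> S" "x \<in> S \<Longrightarrow> x \<in> \<rat>"
  using S Ints_subset_Rats by auto

lemma W_subset_L: "x \<in> W S \<Longrightarrow> x \<in> L"
  by (auto elim!: W_E intro!: sum_L L_closed(2) e_L intro: Rats_L S_closed)

lemma W_add: "x \<in> W S \<Longrightarrow> y \<in> W S \<Longrightarrow> x + y \<in> W S"
  by (elim W_E, rule W_I[of "\<lambda>i. _ i + _ i"])
     (auto intro: S_closed simp: sum.distrib distrib_right)

lemma W_smult: "q \<in> S \<Longrightarrow> x \<in> W S \<Longrightarrow> q * x \<in> W S"
  by (elim W_E, rule W_I[of "\<lambda>i. q * _ i"])
     (auto intro: S_closed simp: sum_distrib_left mult.assoc)

lemma W_uminus: "x \<in> W S \<Longrightarrow> - x \<in> W S"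
  using W_smult[of "-1" x] S_closed by simp

lemma W_diff: "x \<in> W S \<Longrightarrow> y \<in> W S \<Longrightarrow> x - y \<in> W S"
  using W_add[of x "- y"] W_uminus by simp

text \<open>The \<open>e i\<close> add up to -1, so a scalar \<open>q\<close> has all coefficients
  equal to \<open>- q\<close>.\<close>

lemma W_scalar: "q \<in> S \<Longrightarrow> q \<in> W S"
  by (rule W_I[of "\<lambda>_. - q"])
     (simp_all only: S_closed sum_distrib_left[symmetric] sum_e, simp)

lemma W_sum: "(\<And>i. i \<in> A \<Longrightarrow> f i \<in> W S) \<Longrightarrow> (\<Sum>i\<in>A. f i) \<in> W S"
  by (induction A rule: infinite_finite_induct) (auto intro: W_add W_scalar S_closed)

lemma W_root_pow: "\<zeta> ^ m \<in> W S"
proof (cases "p dvd m")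
  case True
  then have "\<zeta> ^ m = 1"
    using root_pow_eq_iff[of m 0] by (simp add: cong_0_iff)
  then show ?thesis by (simp add: W_scalar S_closed)
next
  case False
  then obtain j where j: "j < n" "\<zeta> ^ m = e j" using root_pow_eq_e by blast
  then show ?thesis
    by (intro W_I[of "\<lambda>i. if i = j then 1 else 0"])
       (auto intro: S_closed simp: if_distrib[of "\<lambda>x. x * _"] cong: if_cong)
qed

lemma W_mult: "x \<in> W S \<Longrightarrow> y \<in> W S \<Longrightarrow> x * y \<in> W S"
proof -
  assume "x \<in> W S" "y \<in> W S"
  then obtain c d where c: "\<And>i. c i \<in> S" "x = (\<Sum>i<n. c i * e i)"
    and d: "\<And>i. d i \<in> S" "y = (\<Sum>i<n. d i * e i)"
    by (auto elim!: W_E)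
  have "x * y = (\<Sum>i<n. \<Sum>j<n. (c i * d j) * \<zeta> ^ (g ^ i + g ^ j))"
    by (simp add: c(2) d(2) sum_product e_def power_add mult_ac)
  also have "\<dots> \<in> W S"
    by (intro W_sum W_smult S_closed c d W_root_pow)
  finally show ?thesis .
qed

lemma W_power: "x \<in> W S \<Longrightarrow> x ^ k \<in> W S"
  by (induction k) (auto intro: W_mult W_scalar S_closed)

lemma W_prod: "(\<And>i. i \<in> A \<Longrightarrow> f i \<in> W S) \<Longrightarrow> (\<Prod>i\<in>A. f i) \<in> W S"
  by (induction A rule: infinite_finite_induct) (auto intro: W_mult W_scalar S_closed)

end

text \<open>The shift by \<open>k * (n - 1)\<close> is a shift by \<open>- k\<close> modulo the period \<open>n\<close>.\<close>

lemma pow_combination: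
  assumes c: "\<And>i. c i \<in> \<rat>" and per: "\<And>i. c (i + n) = c i"
  shows "\<sigma>\<^sub>k k (\<Sum>i<n. c i * e i) = (\<Sum>i<n. c (i + k * (n - 1)) * e i)"
proof -
  have per': "c (i + n * m) = c i" for i m
  proof (induction m)
    case (Suc m)
    then show ?case using per[of "i + n * m"] by (simp add: add_ac)
  qed simp
  have idx: "k + i + k * (n - 1) = i + n * k" for i
    using n_pos by (cases n) (auto simp: algebra_simps)
  have "\<sigma>\<^sub>k k (\<Sum>i<n. c i * e i) = (\<Sum>i<n. c i * e (i + k))"
    by (simp add: pow_sum L_closed(2) pow_mult pow_Rats pow_e c e_L Rats_L)
  also have "\<dots> = (\<Sum>i<n. c (k + i + k * (n - 1)) * e (k + i))"
    unfolding idx per' by (simp add: add.commute)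
  also have "\<dots> = (\<Sum>i<n. c (i + k * (n - 1)) * e i)"
    using per[of "_ + k * (n - 1)"]
    by (intro sum_periodic_shift[of "\<lambda>i. c (i + k * (n - 1)) * e i"]) (simp add: e_period add_ac)
  finally show ?thesis .
qed

text \<open>Uniqueness of coefficients turns invariance under an iterate into periodicity.
  Uniqueness speaks of indices below \<open>n\<close> only; reduction modulo \<open>n\<close> covers
  the others.\<close>

lemma fixed_combination:
  assumes c: "\<And>i. c i \<in> \<rat>" and per: "\<And>i. c (i + n) = c i"
    and fixed: "\<sigma>\<^sub>k k (\<Sum>i<n. c i * e i) = (\<Sum>i<n. c i * e i)"
  shows "c (i + k) = c i"
proof -
  have per': "c (i + n * m) = c i" for i m
  proof (induction m)
    case (Suc m)
    then show ?case using per[of "i + n * m"] by (simp add: add_ac)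
  qed simp
  have mod: "c i = c (i mod n)" for i
    using per'[of "i mod n" "i div n"] by (simp add: mult.commute)
  have eq: "c (j + k * (n - 1)) = c j" if "j < n" for j
    using e_independent[of "\<lambda>j. c (j + k * (n - 1))" c j] that c
      fixed[unfolded pow_combination[of c, OF c per]] by blast
  have "c i = c ((i + k) mod n + k * (n - 1))"
  proof -
    have "c i = c (i + n * k)" by (simp add: per')
    also have "i + n * k = i + k + k * (n - 1)"
      using n_pos by (cases n) (auto simp: algebra_simps)
    also have "c \<dots> = c ((i + k + k * (n - 1)) mod n)" by (rule mod)
    also have "\<dots> = c ((i + k) mod n + k * (n - 1))"
      using mod[of "(i + k) mod n + k * (n - 1)"] by (simp add: mod_add_left_eq)
    finally show ?thesis .
  qed
  also have "\<dots> = c (i + k)"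
    using eq[of "(i + k) mod n"] n_pos mod[of "i + k"] by simp
  finally show ?thesis by simp
qed

section \<open>Fixed elements, norms and inverses\<close>

text \<open>All coefficients coincide by \<open>fixed_combination\<close>, and the
  \<open>e i\<close> add up to -1, so the element is minus the common coefficient.\<close>

lemma fixed_W:
  assumes S: "S = \<int> \<or> S = \<rat>" and x: "x \<in> W S" "\<sigma> x = x"
  shows "x \<in> S"
proof -
  obtain c where c: "\<And>i. c i \<in> S" "\<And>i. c (i + n) = c i" "x = (\<Sum>i<n. c i * e i)"
    using x by (auto elim!: W_E)
  have "c (i + 1) = c i" for i
    by (rule fixed_combination) (use c x S_closed[OF S] in auto)
  then have const: "c i = c 0" for i by (induction i) auto
  have "x = (\<Sum>i<n. c 0 * e i)"
    unfolding c(3) by (intro sum.cong refl arg_cong2[of _ _ _ _ "(*)"] const)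
  then have "x = - c 0"
    by (simp add: sum_e sum_distrib_left[symmetric])
  then show ?thesis using c(1) S_closed[OF S] by simp
qed

lemma W_Rats: "x \<in> W \<int> \<Longrightarrow> x \<in> \<rat> \<Longrightarrow> x \<in> \<int>"
  using fixed_W[of \<int>] \<sigma>_Rats by simp

lemma W_pow: "S = \<int> \<or> S = \<rat> \<Longrightarrow> x \<in> W S \<Longrightarrow> \<sigma>\<^sub>k k x \<in> W S"
proof -
  assume S: "S = \<int> \<or> S = \<rat>" and "x \<in> W S"
  then obtain c where c: "\<And>i. c i \<in> S" "\<And>i. c (i + n) = c i" "x = (\<Sum>i<n. c i * e i)"
    by (auto elim!: W_E)
  show ?thesis
    unfolding c(3) pow_combination[of c, OF S_closed(6)[OF S c(1)] c(2)]
    by (rule W_I[OF _ refl]) (rule c(1))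
qed

lemma pow_n: "x \<in> W \<rat> \<Longrightarrow> \<sigma>\<^sub>k n x = x"
  by (auto elim!: W_E simp: pow_sum L_closed e_L Rats_L pow_mult pow_Rats pow_e e_period)

text \<open>The inverse is the product of the other conjugates divided by the norm. The norm is
  rational because \<sigma> permutes its factors cyclically.\<close>

lemma W_inverse: "x \<in> W \<rat> \<Longrightarrow> x \<noteq> 0 \<Longrightarrow> inverse x \<in> W \<rat>"
proof -
  assume x: "x \<in> W \<rat>" "x \<noteq> 0"
  let ?y = "\<Prod>k\<in>{1..<n}. \<sigma>\<^sub>k k x"
  have xL: "x \<in> L" using W_subset_L[of \<rat>] x by simp
  have mem: "\<sigma>\<^sub>k k x \<in> W \<rat>" for k by (simp add: W_pow x)
  have y: "?y \<in> W \<rat>" by (intro W_prod mem) auto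
  have N: "x * ?y = (\<Prod>k<n. \<sigma>\<^sub>k k x)"
    using prod.atLeast_Suc_lessThan[OF n_pos, of "\<lambda>k. \<sigma>\<^sub>k k x"]
    by (simp add: lessThan_atLeast0)
  have "\<sigma> (x * ?y) = (\<Prod>k<n. \<sigma>\<^sub>k (Suc k) x)"
    unfolding N using pow_prod[of "{..<n}" "\<lambda>k. \<sigma>\<^sub>k k x" 1] pow_mem xL by simp
  \<comment> \<open>Both products complete to the one over \<open>k < Suc n\<close>: the shifted one
    by \<open>x\<close>, the other by \<open>\<sigma>\<^sub>k n x = x\<close>. Then the nonzero
    \<open>x\<close> cancels.\<close>
  also have "\<dots> = (\<Prod>k<n. \<sigma>\<^sub>k k x)"
  proof -
    have "x * (\<Prod>k<n. \<sigma>\<^sub>k (Suc k) x) = (\<Prod>k<Suc n. \<sigma>\<^sub>k k x)"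
      by (subst prod.lessThan_Suc_shift) simp
    also have "\<dots> = (\<Prod>k<n. \<sigma>\<^sub>k k x) * x"
      by (simp only: prod.lessThan_Suc pow_n[OF x(1)])
    finally show ?thesis using x(2) by simp
  qed
  also have "\<dots> = x * ?y" by (rule N[symmetric])
  finally have q: "x * ?y \<in> \<rat>"
    by (intro fixed_W[of \<rat>] W_mult x y disjI2 refl)
  have "\<sigma>\<^sub>k k x \<noteq> 0" for k
    using pow_inj[OF xL Rats_L[OF Rats_0], of k] x(2) pow_Rats[OF Rats_0, of k] by metis
  then have "?y \<noteq> 0" by simp
  then have "inverse x = inverse (x * ?y) * ?y" using x by simp
  moreover have "inverse (x * ?y) * ?y \<in> W \<rat>"
    by (intro W_smult y Rats_inverse q disjI2 refl)
  ultimately show ?thesis by metis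
qed

lemma L_eq: "L = W \<rat>"
proof
  show "W \<rat> \<subseteq> L" using W_subset_L by blast
  show "L \<subseteq> W \<rat>"
  proof
    fix x assume "x \<in> L"
    then have "x \<in> generate_field complex_ring (insert \<zeta> \<rat>)"
      by (simp add: L_def rat_adjoin_def)
    then show "x \<in> W \<rat>"
    proof (induction rule: generate_field.induct)
      case one
      show ?case by (simp add: W_scalar)
    next
      case (incl h)
      then show ?case using W_root_pow[of \<rat> 1] by (auto simp: W_scalar)
    next
      case (a_inv h)
      then show ?case by (simp add: W_uminus)
    next
      case (m_inv h)
      then show ?case by (simp add: W_inverse)
    next
      case (eng_add h1 h2)
      then show ?case by (simp add: W_add)
    next
      case (eng_mult h1 h2)
      then show ?case by (simp add: W_mult)
    qed
  qed
qed

section \<open>Integers of the cyclotomic field\<close>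

text \<open>
  Unlike for \<^const>\<open>algebraic_int\<close>, closure under sums and products is immediate from the definition.
\<close>

definition almost_integral :: "complex \<Rightarrow> bool" where
  "almost_integral x \<longleftrightarrow> (\<exists>D::int. D \<noteq> 0 \<and> (\<forall>k. of_int D * x ^ k \<in> W \<int>))"

lemma almost_integral_W: "x \<in> W \<int> \<Longrightarrow> almost_integral x"
  unfolding almost_integral_def by (intro exI[of _ 1]) (auto intro: W_power)

lemma almost_integral_mult:
  assumes "almost_integral x" "almost_integral y"
  shows "almost_integral (x * y)"
proof -
  obtain C D :: int where C: "C \<noteq> 0" "\<And>k. of_int C * x ^ k \<in> W \<int>"
    and D: "D \<noteq> 0" "\<And>k. of_int D * y ^ k \<in> W \<int>"
    using assms by (auto simp: almost_integral_def)
  have "of_int (C * D) * (x * y) ^ k \<in> W \<int>" for k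
    using W_mult[OF _ C(2)[of k] D(2)[of k]] by (simp add: power_mult_distrib mult_ac)
  then show ?thesis
    unfolding almost_integral_def using C D by (intro exI[of _ "C * D"]) simp
qed

lemma almost_integral_add:
  assumes "almost_integral x" "almost_integral y"
  shows "almost_integral (x + y)"
proof -
  obtain C D :: int where C: "C \<noteq> 0" "\<And>k. of_int C * x ^ k \<in> W \<int>"
    and D: "D \<noteq> 0" "\<And>k. of_int D * y ^ k \<in> W \<int>"
    using assms by (auto simp: almost_integral_def)
  have "of_int (C * D) * (x + y) ^ k \<in> W \<int>" for k
  proof -
    have "of_int (C * D) * (x + y) ^ k =
        (\<Sum>i\<le>k. of_nat (k choose i) * ((of_int C * x ^ i) * (of_int D * y ^ (k - i))))"
      by (simp add: binomial_ring sum_distrib_left mult_ac)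
    also have "\<dots> \<in> W \<int>"
      by (intro W_sum W_smult W_mult C D) auto
    finally show ?thesis .
  qed
  then show ?thesis
    unfolding almost_integral_def using C D by (intro exI[of _ "C * D"]) simp
qed

lemma almost_integral_sum:
  "(\<And>i. i \<in> A \<Longrightarrow> almost_integral (f i)) \<Longrightarrow> almost_integral (\<Sum>i\<in>A. f i)"
  by (induction A rule: infinite_finite_induct)
     (auto intro: almost_integral_add almost_integral_W[OF W_scalar[of \<int> 0]])

lemma almost_integral_power: "almost_integral x \<Longrightarrow> almost_integral (x ^ k)"
  by (induction k) (auto intro: almost_integral_mult almost_integral_W[OF W_scalar[of \<int> 1]])

lemma almost_integral_diff: "almost_integral x \<Longrightarrow> almost_integral y \<Longrightarrow> almost_integral (x - y)"
  using almost_integral_add[of x "-1 * y"] almost_integral_mult[of "-1" y]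
    almost_integral_W[OF W_scalar[of \<int> "-1"]] by simp

lemma almost_integral_pow:
  assumes "x \<in> L" "almost_integral x"
  shows "almost_integral (\<sigma>\<^sub>k j x)"
proof -
  obtain D :: int where D: "D \<noteq> 0" "\<And>k. of_int D * x ^ k \<in> W \<int>"
    using assms by (auto simp: almost_integral_def)
  have "\<sigma>\<^sub>k j (of_int D * x ^ k) = of_int D * \<sigma>\<^sub>k j x ^ k" for k
    using assms by (simp add: pow_mult Rats_L power_L pow_Rats pow_power)
  then have "of_int D * \<sigma>\<^sub>k j x ^ k \<in> W \<int>" for k
    using W_pow[OF _ D(2)[of k], of j] by simp
  then show ?thesis using D by (auto simp: almost_integral_def)
qed

text \<open>If \<open>b\<close> is the reduced denominator, every power of \<open>b\<close> divides
  the fixed nonzero \<open>D\<close>, which forces \<open>b = 1\<close>.\<close>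

lemma almost_integral_Rats:
  assumes "x \<in> \<rat>" "almost_integral x"
  shows "x \<in> \<int>"
proof -
  obtain D :: int where D: "D \<noteq> 0" "\<And>k. of_int D * x ^ k \<in> W \<int>"
    using assms by (auto simp: almost_integral_def)
  obtain a b :: int where ab: "b > 0" "coprime a b" "x = of_int a / of_int b"
    using assms(1) by (auto elim: Rats_cases')
  have dvd: "b ^ k dvd D" for k
  proof -
    have "of_int D * x ^ k \<in> \<int>"
      using D(2) assms(1) by (intro W_Rats) auto
    then obtain m where "of_int D * x ^ k = of_int m" by (auto elim: Ints_cases)
    then have "of_int (D * a ^ k) = (of_int (m * b ^ k) :: complex)"
      using ab(1) by (simp add: ab(3) field_simps)
    then have "b ^ k dvd D * a ^ k" by (metis dvd_triv_right of_int_eq_iff)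
    then show ?thesis
      using ab(2) by (metis coprime_commute coprime_dvd_mult_left_iff coprime_power_left_iff
          coprime_power_right_iff)
  qed
  have "b = 1"
  proof (rule ccontr)
    assume "b \<noteq> 1"
    then have "b \<ge> 2" using ab(1) by simp
    have "\<bar>D\<bar> < 2 ^ nat \<bar>D\<bar>"
      using less_exp[of "nat \<bar>D\<bar>"] by (metis abs_ge_zero nat_less_numeral_power_cancel_iff)
    also have "\<dots> \<le> b ^ nat \<bar>D\<bar>"
      using \<open>b \<ge> 2\<close> by (intro power_mono) auto
    also have "\<dots> \<le> \<bar>D\<bar>"
      using dvd_imp_le_int[OF D(1) dvd[of "nat \<bar>D\<bar>"]] ab(1) by simp
    finally show False by simp
  qed
  then show ?thesis by (simp add: ab(3))
qed

text \<open>\<open>M\<close> is any set stable under integer multiples, so that both \<int> and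
  \<open>W \<int>\<close> can be inserted.\<close>

lemma common_denominator:
  assumes M: "\<And>m x. x \<in> M \<Longrightarrow> of_int m * x \<in> M"
    and "finite A" and "\<And>a. a \<in> A \<Longrightarrow> \<exists>d::int. d \<noteq> 0 \<and> of_int d * f a \<in> M"
  shows "\<exists>d::int. d \<noteq> 0 \<and> (\<forall>a\<in>A. of_int d * f a \<in> (M :: complex set))"
  using assms(2,3)
proof (induction A rule: finite_induct)
  case (insert a A)
  then obtain d d' :: int where d: "d \<noteq> 0" "\<forall>a\<in>A. of_int d * f a \<in> M"
    and d': "d' \<noteq> 0" "of_int d' * f a \<in> M"
    by (metis insert_iff)
  have "of_int (d' * d) * f x \<in> M" if "x \<in> insert a A" for x
    using that d d' M[of "of_int d * f x" d'] M[of "of_int d' * f x" d] by (auto simp: mult_ac)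
  then show ?case using d d' by (intro exI[of _ "d' * d"]) auto
qed (auto intro: exI[of _ 1])

lemma L_denominator: "x \<in> L \<Longrightarrow> \<exists>d::int. d \<noteq> 0 \<and> of_int d * x \<in> W \<int>"
proof -
  assume "x \<in> L"
  then obtain c where c: "\<And>i. c i \<in> \<rat>" "x = (\<Sum>i<n. c i * e i)"
    by (auto simp: L_eq elim!: W_E)
  have "\<exists>d::int. d \<noteq> 0 \<and> (\<forall>i\<in>{..<n}. of_int d * c i \<in> \<int>)"
  proof (rule common_denominator)
    fix i
    obtain a b where "b > 0" "c i = of_int a / of_int b" using c(1)[of i] by (auto elim: Rats_cases')
    then show "\<exists>d::int. d \<noteq> 0 \<and> of_int d * c i \<in> \<int>" by (intro exI[of _ b]) auto
  qed auto
  then obtain d :: int where d: "d \<noteq> 0" "\<And>i. i < n \<Longrightarrow> of_int d * c i \<in> \<int>" by auto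
  then have "of_int d * x \<in> W \<int>"
    by (intro W_I[of "\<lambda>i. of_int d * c i"]) (auto simp: c(2) sum_distrib_left mult_ac)
  then show ?thesis using d by blast
qed

text \<open>A common denominator for the powers below the degree of a monic integral equation works
  for all powers, since the equation reduces higher powers with integer coefficients.\<close>

lemma algebraic_int_imp_almost_integral:
  assumes "x \<in> L" "algebraic_int x"
  shows "almost_integral x"
proof -
  obtain P where P: "Polynomial.lead_coeff P = 1" "\<And>i. Polynomial.coeff P i \<in> \<int>" "poly P x = 0"
    using assms(2) by (auto elim: algebraic_int.cases)
  define m where "m = Polynomial.degree P"
  have red: "x ^ m = (\<Sum>i<m. (- Polynomial.coeff P i) * x ^ i)"
  proof -
    have "{..m} = insert m {..<m}" by auto
    then have "poly P x = x ^ m + (\<Sum>i<m. Polynomial.coeff P i * x ^ i)"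
      using P(1) by (simp add: poly_altdef m_def)
    then show ?thesis using P(3) by (simp add: sum_negf eq_neg_iff_add_eq_0)
  qed
  have "\<exists>d::int. d \<noteq> 0 \<and> (\<forall>i\<in>{..<m}. of_int d * x ^ i \<in> W \<int>)"
    by (rule common_denominator) (auto intro: W_smult L_denominator power_L assms)
  then obtain d :: int where d: "d \<noteq> 0" "\<And>i. i < m \<Longrightarrow> of_int d * x ^ i \<in> W \<int>" by auto
  have "of_int d * x ^ k \<in> W \<int>" for k
  proof (induction k rule: less_induct)
    case (less k)
    show ?case
    proof (cases "k < m")
      case False
      have "x ^ k = x ^ (k - m) * x ^ m"
        using False by (simp flip: power_add)
      also have "\<dots> = (\<Sum>i<m. (- Polynomial.coeff P i) * x ^ (k - m + i))"
        unfolding red by (simp add: sum_distrib_left power_add mult_ac)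
      finally have "of_int d * x ^ k = (\<Sum>i<m. (- Polynomial.coeff P i) * (of_int d * x ^ (k - m + i)))"
        by (simp add: sum_distrib_left mult_ac)
      also have "\<dots> \<in> W \<int>"
        using False by (intro W_sum W_smult less) (auto simp: P)
      finally show ?thesis .
    qed (use d in auto)
  qed
  then show ?thesis using d by (auto simp: almost_integral_def)
qed

section \<open>The prime element 1 - \<zeta> and removal of the denominator\<close>

text \<open>Both sides are values at 1 of the cyclotomic polynomial, written once as the product
  over its roots and once as a sum of \<open>p\<close> monomials.\<close>

lemma prod_one_minus_e: "(\<Prod>i<n. 1 - e i) = of_nat p"
proof -
  let ?P = "\<Prod>i<n. [:- e i, 1:]" and ?Q = "\<Sum>j<p. Polynomial.monom (1::complex) j"
  have "?P = ?Q"
  \<comment> \<open>Equal coefficients at \<open>n\<close> leave a difference of degree below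
    \<open>n\<close>, which cannot vanish at the \<open>n\<close> points \<open>e i\<close> unless
    it is zero.\<close>
  proof (rule poly_eqI_degree_lead_coeff[of _ n _ "e ` {..<n}"])
    have degP: "Polynomial.degree ?P = n" by (subst degree_prod_sum_eq) auto
    then show "Polynomial.degree ?P \<le> n" by simp
    have "Polynomial.coeff ?P n = 1"
      using lead_coeff_prod[of "\<lambda>i. [:- e i, 1:]" "{..<n}"] degP by simp
    moreover have "Polynomial.coeff ?Q n = 1"
      using Suc_n by (simp add: coeff_sum)
    ultimately show "Polynomial.coeff ?P n = Polynomial.coeff ?Q n" by simp
    show "Polynomial.degree ?Q \<le> n"
      using Suc_n by (intro degree_sum_le) (auto intro: order.trans[OF degree_monom_le])
    have "inj_on e {..<n}" using e_inj by (auto intro: inj_onI)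
    then show "n \<le> card (e ` {..<n})" by (simp add: card_image)
    fix z assume "z \<in> e ` {..<n}"
    then obtain i where i: "i < n" "z = e i" by auto
    have "z \<noteq> 1"
      using not_dvd_g_pow[of i] root_pow_eq_iff[of "g ^ i" 0] by (simp add: i e_def cong_0_iff)
    moreover have "z ^ p = 1"
      by (simp add: i e_def flip: power_mult) (simp add: mult.commute power_mult root_pow_p)
    ultimately have "poly ?Q z = 0"
      using one_diff_power_eq[of z p] by (simp add: poly_sum poly_monom)
    moreover have "poly ?P z = 0" using i by (auto simp: poly_prod)
    ultimately show "poly ?P z = poly ?Q z" by simp
  qed
  from arg_cong[OF this, of "\<lambda>P. poly P 1"] show ?thesis
    by (simp add: poly_prod poly_sum poly_monom)
qed

text \<open>In \<open>prod_one_minus_e\<close>, each factor \<open>1 - \<zeta> ^ m\<close> is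
  \<open>1 - \<zeta>\<close> times a geometric sum; \<epsilon> collects these sums.\<close>

lemma p_eq_power: obtains \<epsilon> where "\<epsilon> \<in> W \<int>" "of_nat p = (1 - \<zeta>) ^ n * \<epsilon>"
proof
  let ?\<epsilon> = "\<Prod>i<n. \<Sum>j<g ^ i. \<zeta> ^ j"
  show "?\<epsilon> \<in> W \<int>" by (intro W_prod W_sum W_root_pow) auto
  show "of_nat p = (1 - \<zeta>) ^ n * ?\<epsilon>"
    by (simp add: e_def one_diff_power_eq prod.distrib flip: prod_one_minus_e)
qed

text \<open>In the binomial expansion the inner coefficients are divisible by \<open>p\<close>, and
  the two outer terms cancel because \<open>p\<close> is odd.\<close>

lemma power_eq_p: obtains v where "v \<in> W \<int>" "(1 - \<zeta>) ^ p = of_nat p * v"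
proof
  let ?v = "\<Sum>k\<in>{1..<p}. of_nat ((p choose k) div p) * (- \<zeta>) ^ k"
  have "(- \<zeta>) ^ k \<in> W \<int>" for k
    using W_power[of \<int> "- \<zeta>" k] W_uminus[of \<int> \<zeta>] W_root_pow[of \<int> 1] by simp
  then show "?v \<in> W \<int>" by (intro W_sum W_smult) auto
  have "(1 - \<zeta>) ^ p = (\<Sum>k\<le>p. of_nat (p choose k) * (- \<zeta>) ^ k)"
    using binomial_ring[of "- \<zeta>" 1 p] by simp
  also have "{..p} = insert 0 (insert p {1..<p})" by auto
  also have "(\<Sum>k\<in>insert 0 (insert p {1..<p}). of_nat (p choose k) * (- \<zeta>) ^ k) =
      1 + ((- \<zeta>) ^ p + (\<Sum>k\<in>{1..<p}. of_nat (p choose k) * (- \<zeta>) ^ k))"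
    using p_gt_2 by simp
  also have "(- \<zeta>) ^ p = -1" using odd root_pow_p by simp
  also have "(\<Sum>k\<in>{1..<p}. of_nat (p choose k) * (- \<zeta>) ^ k) = of_nat p * ?v"
    unfolding sum_distrib_left
  proof (intro sum.cong refl)
    fix k assume "k \<in> {1..<p}"
    then have "p dvd (p choose k)"
      by (intro dvd_choose_prime) (use prime in auto)
    then have "of_nat (p choose k) = (of_nat p * of_nat ((p choose k) div p) :: complex)"
      by (metis dvd_mult_div_cancel of_nat_mult)
    then show "of_nat (p choose k) * (- \<zeta>) ^ k = of_nat p * (of_nat ((p choose k) div p) * (- \<zeta>) ^ k)"
      by simp
  qed
  finally show "(1 - \<zeta>) ^ p = of_nat p * ?v" by simp
qed

text \<open>Taking \<open>p\<close>-th powers gives \<open>m ^ p = p * (v * z ^ p)\<close>. The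
  cofactor is rational and almost integral, hence an integer, so \<open>p\<close> divides
  \<open>m ^ p\<close>.\<close>

lemma dvd_if_multiple_of_prime_element:
  assumes "of_int m = (1 - \<zeta>) * z" "almost_integral z"
  shows "int p dvd m"
proof -
  obtain v where v: "v \<in> W \<int>" "(1 - \<zeta>) ^ p = of_nat p * v" by (rule power_eq_p)
  have p0: "of_nat p \<noteq> (0::complex)" using p_gt_2 by simp
  have "of_int m ^ p = of_nat p * (v * z ^ p)"
    unfolding assms(1) power_mult_distrib v(2) by simp
  then have eq: "v * z ^ p = of_int m ^ p / of_nat p" using p0 by (simp add: field_simps)
  have "v * z ^ p \<in> \<int>"
  proof (rule almost_integral_Rats)
    show "v * z ^ p \<in> \<rat>" unfolding eq by auto
    show "almost_integral (v * z ^ p)"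
      by (intro almost_integral_mult almost_integral_power almost_integral_W v assms)
  qed
  then obtain j where "of_int m ^ p / of_nat p = (of_int j :: complex)"
    unfolding eq by (auto elim: Ints_cases)
  then have "of_int (m ^ p) = (of_int (int p * j) :: complex)"
    using p0 by (simp add: field_simps)
  then have "int p dvd m ^ p" by (metis dvd_triv_left of_int_eq_iff)
  then show ?thesis using prime prime_dvd_power_int by auto
qed

text \<open>Induction on \<open>k\<close>: the earlier terms are multiples of \<open>p\<close> and
  move to the right-hand side, where everything is divisible by the \<open>n\<close>-th power of
  \<open>1 - \<zeta>\<close>. Comparing at degree \<open>k < n\<close> makes \<open>d k\<close> a
  multiple of \<open>1 - \<zeta>\<close>.\<close>

lemma dvd_prime_element_expansion:
  fixes d :: "nat \<Rightarrow> int"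
  assumes "(\<Sum>k<n. of_int (d k) * (1 - \<zeta>) ^ k) = of_nat p * y" "almost_integral y" "k < n"
  shows "int p dvd d k"
  using assms(3)
proof (induction k rule: less_induct)
  case (less k)
  define l where "l = 1 - \<zeta>"
  have l: "l \<in> W \<int>"
    unfolding l_def using W_root_pow[of \<int> 1] by (simp add: W_diff W_scalar)
  have l0: "l \<noteq> 0" using root_pow_ne[of 1] p_gt_2 by (simp add: l_def)
  \<comment> \<open>\<open>p * w\<close> is the part below degree \<open>k\<close>, by the induction
    hypothesis, and \<open>l ^ (k + 1) * r\<close> is the part above it.\<close>
  define w where "w = (\<Sum>j<k. of_int (d j div int p) * l ^ j)"
  define r where "r = (\<Sum>j<n - k - 1. of_int (d (k + 1 + j)) * l ^ j)"
  have w: "w \<in> W \<int>" and r: "r \<in> W \<int>"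
    unfolding w_def r_def by (auto intro!: W_sum W_smult W_power l)
  obtain \<epsilon> where \<epsilon>: "\<epsilon> \<in> W \<int>" "of_nat p = l ^ n * \<epsilon>"
    unfolding l_def by (rule p_eq_power)
  have w': "of_nat p * w = (\<Sum>j<k. of_int (d j) * l ^ j)"
    unfolding w_def sum_distrib_left
  proof (intro sum.cong refl)
    fix j assume "j \<in> {..<k}"
    then have "d j = int p * (d j div int p)" using less by simp
    then have "of_int (d j) = (of_nat p * of_int (d j div int p) :: complex)"
      by (metis of_int_mult of_int_of_nat_eq)
    then show "of_nat p * (of_int (d j div int p) * l ^ j) = of_int (d j) * l ^ j" by simp
  qed
  have split: "(\<Sum>j<k + m. f j) = (\<Sum>j<k. f j) + (\<Sum>j<m. f (k + j))"
    for m and f :: "nat \<Rightarrow> complex"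
    by (induction m) (auto simp: algebra_simps)
  have "(\<Sum>j<n. of_int (d j) * l ^ j) =
      (\<Sum>j<k + Suc (n - k - 1). of_int (d j) * l ^ j)" using less by simp
  also have "\<dots> = (\<Sum>j<k. of_int (d j) * l ^ j) +
      (\<Sum>j<Suc (n - k - 1). of_int (d (k + j)) * l ^ (k + j))"
    by (rule split)
  also have "(\<Sum>j<Suc (n - k - 1). of_int (d (k + j)) * l ^ (k + j)) = l ^ k * (of_int (d k) + l * r)"
    by (subst sum.lessThan_Suc_shift) (simp add: r_def sum_distrib_left power_add algebra_simps)
  finally have "l ^ k * (of_int (d k) + l * r) = l ^ n * \<epsilon> * (y - w)"
    using assms(1) w' \<epsilon>(2) by (simp add: algebra_simps l_def)
  \<comment> \<open>As \<open>k < n\<close>, a factor \<open>l\<close> survives the cancellation of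
    \<open>l ^ k\<close>.\<close>
  also have "l ^ n = l ^ k * (l * l ^ (n - k - 1))"
    using less.prems by (simp flip: power_add power_Suc)
  finally have "of_int (d k) + l * r = l * (l ^ (n - k - 1) * \<epsilon> * (y - w))"
    using l0 by (simp add: mult.assoc)
  then have "of_int (d k) = l * (l ^ (n - k - 1) * \<epsilon> * (y - w) - r)"
    by (simp add: algebra_simps)
  moreover have "almost_integral (l ^ (n - k - 1) * \<epsilon> * (y - w) - r)"
    by (intro almost_integral_diff almost_integral_mult almost_integral_W W_power l \<epsilon> assms w r) simp
  ultimately show ?case
    unfolding l_def by (rule dvd_if_multiple_of_prime_element)
qed

text \<open>Binomial expansion of \<zeta> = 1 - (1 - \<zeta>); the bound on \<open>j\<close> keeps
  the degree below \<open>n\<close>.\<close>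

lemma root_pow_expansion:
  assumes "j < n"
  obtains d :: "nat \<Rightarrow> int" where "\<zeta> ^ j = (\<Sum>k<n. of_int (d k) * (1 - \<zeta>) ^ k)"
proof
  let ?d = "\<lambda>k. if k \<le> j then (-1) ^ k * int (j choose k) else 0"
  have expand: "(1 - l) ^ j = (\<Sum>k<n. of_int (?d k) * l ^ k)" for l :: complex
  proof -
    have "(1 - l) ^ j = (\<Sum>k\<le>j. of_nat (j choose k) * (- l) ^ k)"
      using binomial_ring[of "- l" 1 j] by simp
    also have "\<dots> = (\<Sum>k\<le>j. of_int (?d k) * l ^ k)"
      by (intro sum.cong refl) (simp add: power_minus[of l] mult_ac)
    also have "\<dots> = (\<Sum>k<n. of_int (?d k) * l ^ k)"
      using assms by (intro sum.mono_neutral_left) auto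
    finally show ?thesis .
  qed
  from expand[of "1 - \<zeta>"] show "\<zeta> ^ j = (\<Sum>k<n. of_int (?d k) * (1 - \<zeta>) ^ k)"
    by (simp only: diff_diff_eq2 add_diff_cancel_left')
qed

text \<open>The basis uses the exponents 1 to \<open>p - 1\<close>, but
  \<open>root_pow_expansion\<close> covers 0 to \<open>p - 2\<close>. The factor
  \<open>\<zeta> ^ n\<close>, the inverse of \<zeta>, lowers every exponent by one.\<close>

lemma W_Ints_expansion:
  assumes "x \<in> W \<int>"
  obtains d :: "nat \<Rightarrow> int" where "\<zeta> ^ n * x = (\<Sum>k<n. of_int (d k) * (1 - \<zeta>) ^ k)"
proof -
  obtain c where c: "\<And>i. c i \<in> \<int>" "x = (\<Sum>i<n. c i * e i)"
    using assms by (auto elim!: W_E)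
  obtain b where b: "\<And>i. c i = of_int (b i)"
  proof -
    have "\<exists>b. c i = of_int b" for i using c(1)[of i] by (auto elim: Ints_cases)
    then show ?thesis using that by metis
  qed
  have "\<exists>D :: nat \<Rightarrow> int. \<zeta> ^ n * e i = (\<Sum>k<n. of_int (D k) * (1 - \<zeta>) ^ k)" for i
  proof -
    \<comment> \<open>The one exponent out of range would require \<open>g ^ i\<close> to be
      divisible by \<open>p\<close>.\<close>
    have "(n + g ^ i) mod p \<noteq> n"
    proof
      assume "(n + g ^ i) mod p = n"
      then have "[n + g ^ i = n + 0] (mod p)"
        using Suc_n by (simp add: cong_def)
      then have "[g ^ i = 0] (mod p)" by (simp only: cong_add_lcancel_nat)
      then show False using not_dvd_g_pow by (simp add: cong_0_iff)
    qed
    moreover have "(n + g ^ i) mod p < Suc n" using Suc_n p_gt_2 by simp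
    ultimately have "(n + g ^ i) mod p < n" by simp
    then obtain D :: "nat \<Rightarrow> int"
      where "\<zeta> ^ ((n + g ^ i) mod p) = (\<Sum>k<n. of_int (D k) * (1 - \<zeta>) ^ k)"
      by (rule root_pow_expansion)
    then have "\<zeta> ^ n * e i = (\<Sum>k<n. of_int (D k) * (1 - \<zeta>) ^ k)"
      by (simp only: root_pow_mod power_add e_def)
    then show ?thesis by blast
  qed
  then obtain D :: "nat \<Rightarrow> nat \<Rightarrow> int"
    where D: "\<And>i. \<zeta> ^ n * e i = (\<Sum>k<n. of_int (D i k) * (1 - \<zeta>) ^ k)" by metis
  have "\<zeta> ^ n * x = (\<Sum>i<n. of_int (b i) * (\<zeta> ^ n * e i))"
    by (simp add: c(2) b sum_distrib_left mult_ac)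
  also have "\<dots> = (\<Sum>i<n. \<Sum>k<n. of_int (b i * D i k) * (1 - \<zeta>) ^ k)"
    unfolding D by (simp add: sum_distrib_left mult.assoc)
  also have "\<dots> = (\<Sum>k<n. \<Sum>i<n. of_int (b i * D i k) * (1 - \<zeta>) ^ k)"
    by (rule sum.swap)
  also have "\<dots> = (\<Sum>k<n. of_int (\<Sum>i<n. b i * D i k) * (1 - \<zeta>) ^ k)"
    by (simp add: sum_distrib_right)
  finally show ?thesis by (rule that)
qed

text \<open>The coefficients in powers of \<open>1 - \<zeta>\<close> are divisible by
  \<open>p\<close>, so the division can be carried out there. A final factor \<zeta> undoes
  \<open>\<zeta> ^ n\<close>, because \<open>n + 1 = p\<close>.\<close>

lemma W_Ints_divide_p:
  assumes "of_nat p * y \<in> W \<int>" "almost_integral y"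
  shows "y \<in> W \<int>"
proof -
  obtain d :: "nat \<Rightarrow> int"
    where d: "\<zeta> ^ n * (of_nat p * y) = (\<Sum>k<n. of_int (d k) * (1 - \<zeta>) ^ k)"
    using W_Ints_expansion[OF assms(1)] by blast
  have \<zeta>: "\<zeta> \<in> W \<int>" using W_root_pow[of \<int> 1] by simp
  have AI: "almost_integral (\<zeta> ^ n * y)"
    by (intro almost_integral_mult assms almost_integral_W W_power \<zeta>) simp
  have dvd: "int p dvd d k" if "k < n" for k
    using dvd_prime_element_expansion[OF _ AI that, of d] d by (simp add: mult_ac)
  have "of_nat p * (\<zeta> ^ n * y) = of_nat p * (\<Sum>k<n. of_int (d k div int p) * (1 - \<zeta>) ^ k)"
  proof -
    have "of_int (d k) = (of_nat p * of_int (d k div int p) :: complex)" if "k < n" for k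
      using dvd[OF that] by (metis dvd_mult_div_cancel of_int_mult of_int_of_nat_eq)
    then show ?thesis using d by (simp add: sum_distrib_left mult_ac)
  qed
  then have eq: "\<zeta> ^ n * y = (\<Sum>k<n. of_int (d k div int p) * (1 - \<zeta>) ^ k)"
    using p_gt_2 by simp
  have "\<zeta> ^ n * y \<in> W \<int>"
    unfolding eq by (intro W_sum W_smult W_power W_diff \<zeta> W_scalar) auto
  then have "\<zeta> * (\<zeta> ^ n * y) \<in> W \<int>" using W_mult[OF _ \<zeta>] by blast
  moreover have "\<zeta> * (\<zeta> ^ n * y) = y"
    using root_pow_p Suc_n by (metis mult.assoc mult_1 power_Suc)
  ultimately show ?thesis by simp
qed

text \<open>The trace form writes \<open>p\<close> times a coefficient as a sum of almost integral
  numbers. Being rational, it is an integer; the remaining \<open>p\<close> is then divided out of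
  the whole element.\<close>

lemma algebraic_int_in_W:
  assumes "x \<in> L" "algebraic_int x"
  shows "x \<in> W \<int>"
proof -
  have AI: "almost_integral x" by (rule algebraic_int_imp_almost_integral) fact+
  obtain c where c: "\<And>i. c i \<in> \<rat>" "x = (\<Sum>i<n. c i * e i)"
    using assms(1) by (auto simp: L_eq elim!: W_E)
  have eW: "e j \<in> W \<int>" for j unfolding e_def by (rule W_root_pow) simp
  have int: "of_nat p * c j \<in> \<int>" if j: "j < n" for j
  proof (rule almost_integral_Rats)
    show "of_nat p * c j \<in> \<rat>" using c by simp
    have eq: "of_nat p * c j = (\<Sum>k<n. \<sigma>\<^sub>k k (x * (e j ^ n - 1)))"
      using trace_coefficient[of c j] c j by simp
    have "e j ^ n - 1 \<in> W \<int>" by (intro W_diff W_power eW W_scalar) auto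
    then show "almost_integral (of_nat p * c j)"
      unfolding eq
      by (intro almost_integral_sum almost_integral_pow almost_integral_mult AI L_closed(2) assms
          almost_integral_W W_subset_L) auto
  qed
  have "of_nat p * x \<in> W \<int>"
    by (rule W_I[of "\<lambda>i. of_nat p * c i"]) (auto simp: int c(2) sum_distrib_left mult_ac)
  then show ?thesis using AI by (rule W_Ints_divide_p)
qed

section \<open>Integral combinations are algebraic integers\<close>

text \<open>\<sigma> is known to be a homomorphism on \<open>L\<close> only, hence the conditions on
  the coefficients.\<close>

lemma map_poly_\<sigma>_mult:
  assumes "\<And>i. Polynomial.coeff f i \<in> L" "\<And>i. Polynomial.coeff h i \<in> L"
  shows "map_poly \<sigma> (f * h) = map_poly \<sigma> f * map_poly \<sigma> h"
proof (rule poly_eqI)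
  fix m
  have "\<sigma> (\<Sum>i\<le>m. Polynomial.coeff f i * Polynomial.coeff h (m - i)) =
      (\<Sum>i\<le>m. \<sigma> (Polynomial.coeff f i * Polynomial.coeff h (m - i)))"
    using pow_sum[of "{..m}" "\<lambda>i. Polynomial.coeff f i * Polynomial.coeff h (m - i)" 1]
    by (simp add: L_closed(2) assms)
  then show "Polynomial.coeff (map_poly \<sigma> (f * h)) m = Polynomial.coeff (map_poly \<sigma> f * map_poly \<sigma> h) m"
    by (simp add: coeff_map_poly \<sigma>_zero coeff_mult \<sigma>_mult assms)
qed

text \<open>The monic polynomial \<open>P\<close> with the iterates of \<open>x\<close> as roots has
  coefficients in \<open>W \<int>\<close>. Applying \<sigma> permutes its factors, so the
  coefficients are fixed and therefore integers.\<close>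

lemma W_imp_algebraic_int:
  assumes x: "x \<in> W \<int>"
  shows "algebraic_int x"
proof -
  let ?q = "\<lambda>k. [:- \<sigma>\<^sub>k k x, 1:]"
  define P where "P = (\<Prod>k<n. ?q k)"
  have xL: "x \<in> L" using x W_subset_L by blast
  have q: "Polynomial.coeff (?q k) i \<in> W \<int>" for k i
    using W_pow[of \<int> x k] x
    by (auto simp: coeff_pCons W_uminus W_scalar split: nat.splits)
  have coeff_mult_W: "Polynomial.coeff (f * h) i \<in> W \<int>"
    if "\<And>i. Polynomial.coeff f i \<in> W \<int>" "\<And>i. Polynomial.coeff h i \<in> W \<int>" for f h i
    unfolding coeff_mult by (intro W_sum W_mult that) auto
  have coeff_W: "Polynomial.coeff (\<Prod>k<m. ?q k) i \<in> W \<int>" for m i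
  proof (induction m arbitrary: i)
    case (Suc m)
    show ?case unfolding prod.lessThan_Suc by (intro coeff_mult_W Suc q)
  qed (auto simp: W_scalar)
  have map_q: "map_poly \<sigma> (?q k) = ?q (Suc k)" for k
    using pow_diff[of 0 "\<sigma>\<^sub>k k x" 1] xL
    by (simp add: map_poly_pCons \<sigma>_zero \<sigma>_one Rats_L pow_mem)
  have map_prod: "map_poly \<sigma> (\<Prod>k<m. ?q k) = (\<Prod>k<m. ?q (Suc k))" for m
  proof (induction m)
    case (Suc m)
    have "map_poly \<sigma> ((\<Prod>k<m. ?q k) * ?q m) = map_poly \<sigma> (\<Prod>k<m. ?q k) * map_poly \<sigma> (?q m)"
      by (intro map_poly_\<sigma>_mult) (use coeff_W[of m] q W_subset_L[of \<int>] in blast)+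
    then show ?case by (simp only: prod.lessThan_Suc Suc map_q)
  qed (simp add: map_poly_1 \<sigma>_one)
  \<comment> \<open>The product over \<open>k < Suc n\<close> is split at its first and at its last
    factor; these agree, and cancelling them identifies the shifted product with
    \<open>P\<close>.\<close>
  have "?q 0 * (\<Prod>k<n. ?q (Suc k)) = (\<Prod>k<Suc n. ?q k)"
    by (simp only: prod.lessThan_Suc_shift)
  also have "\<dots> = P * ?q n"
    by (simp only: prod.lessThan_Suc P_def)
  also have "?q n = ?q 0"
    using pow_n[of x] xL L_eq by simp
  finally have "?q 0 * (\<Prod>k<n. ?q (Suc k)) = ?q 0 * P"
    by (simp only: mult.commute[of P])
  moreover have "?q 0 \<noteq> 0" by simp
  ultimately have "(\<Prod>k<n. ?q (Suc k)) = P"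
    by (simp only: mult_cancel_left) blast
  then have "map_poly \<sigma> P = P"
    unfolding P_def map_prod .
  then have fix_coeff: "\<sigma> (Polynomial.coeff P i) = Polynomial.coeff P i" for i
    by (metis coeff_map_poly \<sigma>_zero)
  have "\<forall>i. Polynomial.coeff P i \<in> \<int>"
    using fixed_W[of \<int>] coeff_W[of n] fix_coeff by (simp add: P_def)
  moreover have "Polynomial.lead_coeff P = 1"
    unfolding P_def lead_coeff_prod by simp
  moreover have "poly P x = 0"
    using n_pos by (auto simp: P_def poly_prod intro!: bexI[of _ 0])
  ultimately show ?thesis by (metis algebraic_int.intros)
qed

end

section \<open>Subfields and Gaussian periods\<close>

text \<open>Gaussian elimination: an unknown \<open>a\<close> with nonzero coefficient in the last
  equation is eliminated from the others, leaving one equation and one unknown fewer.\<close>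

lemma homogeneous_system_nontrivial:
  fixes A :: "'i \<Rightarrow> nat \<Rightarrow> 'a::field"
  assumes "finite I" "s < card I"
  shows "\<exists>x. (\<exists>i\<in>I. x i \<noteq> 0) \<and> (\<forall>j<s. (\<Sum>i\<in>I. x i * A i j) = 0)"
  using assms
proof (induction s arbitrary: I A)
  case 0
  then have "I \<noteq> {}" by auto
  then show ?case by (intro exI[of _ "\<lambda>_. 1"]) auto
next
  case (Suc s)
  show ?case
  proof (cases "\<forall>i\<in>I. A i s = 0")
    case True
    then show ?thesis
      using Suc.IH[of I A] Suc.prems by (auto simp: less_Suc_eq)
  next
    case False
    then obtain a where a: "a \<in> I" "A a s \<noteq> 0" by auto
    define J where "J = I - {a}"
    have I: "I = insert a J" "a \<notin> J" "finite J" using a Suc.prems by (auto simp: J_def)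
    then have "s < card J" using Suc.prems by simp
    then obtain x where x: "\<exists>i\<in>J. x i \<noteq> 0"
      "\<And>j. j < s \<Longrightarrow> (\<Sum>i\<in>J. x i * (A i j - A i s / A a s * A a j)) = 0"
      using Suc.IH[of J "\<lambda>i j. A i j - A i s / A a s * A a j"] I by auto
    \<comment> \<open>The value at \<open>a\<close> is the one that solves equation
      \<open>s\<close>.\<close>
    define y where "y = x(a := - (\<Sum>i\<in>J. x i * (A i s / A a s)))"
    have y: "(\<Sum>i\<in>I. y i * A i j) = (\<Sum>i\<in>J. x i * (A i j - A i s / A a s * A a j))" for j
    proof -
      have "(\<Sum>i\<in>J. y i * A i j) = (\<Sum>i\<in>J. x i * A i j)"
        using I by (intro sum.cong) (auto simp: y_def)
      then have "(\<Sum>i\<in>I. y i * A i j) =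
          (\<Sum>i\<in>J. x i * A i j) - (\<Sum>i\<in>J. x i * (A i s / A a s)) * A a j"
        using I by (simp add: y_def)
      then show ?thesis
        by (simp add: right_diff_distrib sum_subtractf sum_distrib_right mult.assoc)
    qed
    have "(\<Sum>i\<in>I. y i * A i j) = 0" if "j < Suc s" for j
      using that x(2)[of j] a by (cases "j = s") (auto simp: y)
    moreover have "\<exists>i\<in>I. y i \<noteq> 0"
      using x(1) I by (auto simp: y_def)
    ultimately show ?thesis by blast
  qed
qed

text \<open>Dedekind's argument: the relation at \<open>m * x\<close> minus
  \<open>\<chi> a m\<close> times the relation at \<open>x\<close> no longer involves
  \<open>a\<close>. Where \<open>\<chi> b m\<close> and \<open>\<chi> a m\<close> differ, induction
  gives \<open>c b = 0\<close>; evaluation at 1 then gives \<open>c a = 0\<close>.\<close>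

lemma dedekind_independence:
  fixes \<chi> :: "'i \<Rightarrow> 'b::monoid_mult \<Rightarrow> 'a::field"
  assumes "finite I" and one: "1 \<in> K" and mult: "\<And>x y. x \<in> K \<Longrightarrow> y \<in> K \<Longrightarrow> x * y \<in> K"
    and \<chi>_one: "\<And>i. \<chi> i 1 = 1"
    and \<chi>_mult: "\<And>i x y. x \<in> K \<Longrightarrow> y \<in> K \<Longrightarrow> \<chi> i (x * y) = \<chi> i x * \<chi> i y"
    and "\<And>i j. i \<in> I \<Longrightarrow> j \<in> I \<Longrightarrow> i \<noteq> j \<Longrightarrow> \<exists>x\<in>K. \<chi> i x \<noteq> \<chi> j x"
    and "\<And>x. x \<in> K \<Longrightarrow> (\<Sum>i\<in>I. c i * \<chi> i x) = 0" and "i \<in> I"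
  shows "c i = 0"
  using assms(1,6-)
proof (induction I arbitrary: c i rule: finite_induct)
  case (insert a I)
  have zero: "c b = 0" if b: "b \<in> I" for b
  proof -
    obtain m where m: "m \<in> K" "\<chi> b m \<noteq> \<chi> a m"
      using insert.prems(1)[of b a] insert.hyps b by auto
    have "c b * (\<chi> b m - \<chi> a m) = 0"
    proof (rule insert.IH[where c = "\<lambda>i. c i * (\<chi> i m - \<chi> a m)" and i = b])
      fix x assume x: "x \<in> K"
      have "(\<Sum>i\<in>I. c i * (\<chi> i m - \<chi> a m) * \<chi> i x) =
          (\<Sum>i\<in>insert a I. c i * \<chi> i (m * x)) - \<chi> a m * (\<Sum>i\<in>insert a I. c i * \<chi> i x)"
        using insert.hyps m x
        by (simp add: \<chi>_mult algebra_simps sum_subtractf sum_distrib_left)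
      also have "\<dots> = 0"
        using insert.prems(2)[of x] insert.prems(2)[of "m * x"] mult m x by simp
      finally show "(\<Sum>i\<in>I. c i * (\<chi> i m - \<chi> a m) * \<chi> i x) = 0" .
    qed (use insert.prems(1) b in auto)
    then show ?thesis using m by simp
  qed
  then have "(\<Sum>i\<in>insert a I. c i * \<chi> i 1) = c a"
    using insert.hyps by (simp add: \<chi>_one)
  then have "c a = 0" using insert.prems(2)[OF one] by simp
  then show ?case using zero insert.prems(3) by auto
qed simp

lemma subfield_Rats: "subfield \<rat> complex_ring"
proof (rule field.subfieldI'[OF field_complex_ring])
  show "subring \<rat> complex_ring"
    by (rule complex_ring.subringI) auto
qed auto

lemma combine_complex:
  "length Ks = length Us \<Longrightarrow> complex_ring.combine Ks Us = (\<Sum>i<length Us. Ks ! i * Us ! i)"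
  by (induction Ks Us rule: list_induct2) (simp_all add: sum.lessThan_Suc_shift del: sum.lessThan_Suc)

lemma Span_complex:
  "complex_ring.Span \<rat> Us = {\<Sum>i<length Us. c i * Us ! i | c. \<forall>i<length Us. c i \<in> \<rat>}"
proof -
  have "complex_ring.Span \<rat> Us =
      {complex_ring.combine Ks Us | Ks. length Ks = length Us \<and> set Ks \<subseteq> \<rat>}"
    by (rule complex_ring.Span_eq_combine_set_length_version[OF subfield_Rats]) simp
  also have "\<dots> = {\<Sum>i<length Us. c i * Us ! i | c. \<forall>i<length Us. c i \<in> \<rat>}" (is "?A = ?B")
  proof (intro subset_antisym subsetI)
    fix x assume "x \<in> ?A"
    then obtain Ks where "length Ks = length Us" "set Ks \<subseteq> \<rat>" "x = complex_ring.combine Ks Us"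
      by blast
    then show "x \<in> ?B"
      by (auto simp: combine_complex intro!: exI[of _ "(!) Ks"] dest: nth_mem)
  next
    fix x assume "x \<in> ?B"
    then obtain c where c: "\<forall>i<length Us. c i \<in> \<rat>" "x = (\<Sum>i<length Us. c i * Us ! i)" by blast
    then show "x \<in> ?A"
      by (auto simp: combine_complex intro!: exI[of _ "map c [0..<length Us]"])
  qed
  finally show ?thesis .
qed

lemma dimension_Rats_basis:
  assumes "complex_ring.dimension s \<rat> K"
  obtains v where "\<And>i. i < s \<Longrightarrow> v i \<in> K"
    "\<And>x. x \<in> K \<Longrightarrow> \<exists>c. (\<forall>i<s. c i \<in> \<rat>) \<and> x = (\<Sum>i<s. c i * v i)"
proof -
  obtain Vs where Vs: "length Vs = s" "complex_ring.Span \<rat> Vs = K"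
    using complex_ring.exists_base[OF subfield_Rats assms] by auto
  have "set Vs \<subseteq> K"
    using complex_ring.Span_base_incl[OF subfield_Rats, of Vs] Vs by simp
  then have "Vs ! i \<in> K" if "i < s" for i
    using that Vs(1) nth_mem by blast
  moreover have "\<exists>c. (\<forall>i<s. c i \<in> \<rat>) \<and> x = (\<Sum>i<s. c i * Vs ! i)" if "x \<in> K" for x
    using that Vs(1) unfolding Vs(2)[symmetric] Span_complex by blast
  ultimately show ?thesis by (rule that)
qed

text \<open>The span of \<open>w\<close> has dimension \<open>d\<close> and contains a basis of
  \<open>K\<close> of length \<open>s\<close>, so \<open>s \<le> d\<close>. With equality, that
  basis also spans the larger space.\<close>

lemma dimension_Rats_span:
  assumes dim: "complex_ring.dimension s \<rat> K"
    and ind: "\<And>c i. (\<And>i. i < d \<Longrightarrow> c i \<in> \<rat>) \<Longrightarrow> (\<Sum>i<d. c i * w i) = 0 \<Longrightarrow> i < d \<Longrightarrow> c i = 0"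
    and sub: "K \<subseteq> {\<Sum>i<d. c i * w i | c. \<forall>i<d. c i \<in> \<rat>}" and "d \<le> s"
  shows "s = d" "K = {\<Sum>i<d. c i * w i | c. \<forall>i<d. c i \<in> \<rat>}"
proof -
  define Us where "Us = map w [0..<d]"
  define F where "F = {\<Sum>i<d. c i * w i | c. \<forall>i<d. c i \<in> \<rat>}"
  have F: "complex_ring.Span \<rat> Us = F"
    unfolding Span_complex Us_def F_def by simp
  have "complex_ring.independent \<rat> Us"
  proof (rule ccontr)
    assume dep: "\<not> complex_ring.independent \<rat> Us"
    then obtain Ks where Ks: "length Ks = length Us" "complex_ring.combine Ks Us = 0"
        "set Ks \<subseteq> \<rat>" "set Ks \<noteq> {0}"
      using complex_ring.dependent_imp_non_trivial_combine[OF subfield_Rats, of Us] by auto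
    have "(\<Sum>i<d. Ks ! i * w i) = 0"
      using Ks by (simp add: combine_complex Us_def)
    moreover have "Ks ! i \<in> \<rat>" if "i < d" for i
      using that Ks(1,3) nth_mem[of i Ks] by (simp add: Us_def subset_iff)
    ultimately have "Ks ! i = 0" if "i < d" for i
      using ind[of "(!) Ks" i] that by blast
    then have "set Ks \<subseteq> {0}"
      using Ks(1) by (auto simp: Us_def in_set_conv_nth)
    then have "Us = []" using Ks(1,4) by (auto simp: subset_singleton_iff)
    then show False using dep complex_ring.li_Nil by simp
  qed
  then have dimF: "complex_ring.dimension d \<rat> F"
    using complex_ring.dimensionI[OF subfield_Rats _ F] by (simp add: Us_def)
  obtain Vs where Vs: "complex_ring.independent \<rat> Vs" "length Vs = s" "complex_ring.Span \<rat> Vs = K"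
    using complex_ring.exists_base[OF subfield_Rats dim] by auto
  have sub': "set Vs \<subseteq> F"
    using complex_ring.Span_base_incl[OF subfield_Rats, of Vs] Vs sub by (auto simp: F_def)
  have "s \<le> d"
    using complex_ring.independent_length_le_dimension[OF subfield_Rats dimF Vs(1) sub'] Vs by simp
  then show "s = d" using \<open>d \<le> s\<close> by simp
  then show "K = {\<Sum>i<d. c i * w i | c. \<forall>i<d. c i \<in> \<rat>}"
    using complex_ring.independent_length_eq_dimension[OF subfield_Rats dimF Vs(1) sub'] Vs
    by (simp add: F_def)
qed

section \<open>The subfield and the iterates that fix it\<close>

locale cyclotomic_subfield = cyclotomic_automorphism +
  fixes K :: "complex set" and s :: nat
  assumes subfield_K: "subfield K complex_ring" and K_subset_L: "K \<subseteq> L"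
    and dimension_K: "complex_ring.dimension s \<rat> K"
begin

lemmas Rats_subset_K = subfield_complexD(1)[OF subfield_K]
lemmas K_closed = subfield_complexD(2-)[OF subfield_K]

lemma K_L: "x \<in> K \<Longrightarrow> x \<in> L"
  using K_subset_L by blast

lemma sum_K: "(\<And>i. i \<in> A \<Longrightarrow> f i \<in> K) \<Longrightarrow> (\<Sum>i\<in>A. f i) \<in> K"
  using Rats_subset_K by (induction A rule: infinite_finite_induct) (auto intro: K_closed)

definition fixes_K :: "nat \<Rightarrow> bool" where
  "fixes_K k \<longleftrightarrow> (\<forall>x\<in>K. \<sigma>\<^sub>k k x = x)"

text \<open>The exponents fixing \<open>K\<close> are the multiples of \<open>d\<close>; by
  \<open>s_eq_d\<close> this number is the degree of \<open>K\<close>.\<close>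

definition d :: nat where "d = (LEAST k. k > 0 \<and> fixes_K k)"

lemma fixes_K_n: "fixes_K n"
  using pow_n K_L L_eq by (auto simp: fixes_K_def)

lemma d_pos: "d > 0" and fixes_K_d: "fixes_K d"
  using LeastI[of "\<lambda>k. k > 0 \<and> fixes_K k" n] fixes_K_n n_pos by (auto simp: d_def)

lemma d_least: "0 < k \<Longrightarrow> k < d \<Longrightarrow> \<not> fixes_K k"
  using not_less_Least[of k "\<lambda>k. k > 0 \<and> fixes_K k"] by (auto simp: d_def)

lemma fixes_K_mult: "fixes_K (d * q)"
  using fixes_K_d by (induction q) (auto simp: fixes_K_def funpow_add)

lemma fixes_K_imp_dvd: "fixes_K k \<Longrightarrow> d dvd k"
proof -
  assume k: "fixes_K k"
  have "fixes_K (k mod d)"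
    unfolding fixes_K_def
  proof
    fix x assume x: "x \<in> K"
    have "x = \<sigma>\<^sub>k (k mod d + d * (k div d)) x"
      using k x by (simp add: fixes_K_def)
    also have "\<dots> = \<sigma>\<^sub>k (k mod d) (\<sigma>\<^sub>k (d * (k div d)) x)"
      unfolding funpow_add comp_def ..
    also have "\<sigma>\<^sub>k (d * (k div d)) x = x"
      using fixes_K_mult[of "k div d"] x by (simp add: fixes_K_def)
    finally show "\<sigma>\<^sub>k (k mod d) x = x" by simp
  qed
  then show ?thesis
    using d_least[of "k mod d"] d_pos by (auto simp: dvd_eq_mod_eq_0)
qed

lemma d_dvd_n: "d dvd n"
  by (rule fixes_K_imp_dvd) (rule fixes_K_n)

text \<open>If two iterates agreed on \<open>K\<close>, injectivity would let
  \<open>\<sigma>\<^sub>k (j - i)\<close> fix \<open>K\<close>, against the minimality of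
  \<open>d\<close>.\<close>

lemma pow_distinct:
  assumes "i < j" "j < d"
  shows "\<exists>x\<in>K. \<sigma>\<^sub>k i x \<noteq> \<sigma>\<^sub>k j x"
proof (rule ccontr)
  assume *: "\<not> ?thesis"
  have "\<sigma>\<^sub>k (j - i) x = x" if x: "x \<in> K" for x
  proof -
    have "\<sigma>\<^sub>k i x = \<sigma>\<^sub>k (i + (j - i)) x" using * x assms by simp
    also have "\<dots> = \<sigma>\<^sub>k i (\<sigma>\<^sub>k (j - i) x)" unfolding funpow_add comp_def ..
    finally show ?thesis
      using pow_inj[OF K_L[OF x] pow_mem[OF K_L[OF x]]] by metis
  qed
  then show False
    using d_least[of "j - i"] assms unfolding fixes_K_def by fastforce
qed

text \<open>With \<open>d > s\<close>, the values of the \<open>d\<close> iterates on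
  \<open>s\<close> spanning elements satisfy a nontrivial linear relation. It extends to
  \<open>K\<close> by \<rat>-linearity and contradicts Dedekind independence.\<close>

lemma d_le_s: "d \<le> s"
proof (rule ccontr)
  assume "\<not> d \<le> s"
  then have "s < card {..<d}" by simp
  obtain v where v: "\<And>i. i < s \<Longrightarrow> v i \<in> K"
    "\<And>x. x \<in> K \<Longrightarrow> \<exists>c. (\<forall>i<s. c i \<in> \<rat>) \<and> x = (\<Sum>i<s. c i * v i)"
    by (rule dimension_Rats_basis[OF dimension_K]) blast
  obtain x where x: "\<exists>i\<in>{..<d}. x i \<noteq> 0"
    "\<And>j. j < s \<Longrightarrow> (\<Sum>i<d. x i * \<sigma>\<^sub>k i (v j)) = 0"
    using homogeneous_system_nontrivial[OF _ \<open>s < card {..<d}\<close>, of "\<lambda>i j. \<sigma>\<^sub>k i (v j)"] by auto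
  have zero: "(\<Sum>i<d. x i * \<sigma>\<^sub>k i y) = 0" if "y \<in> K" for y
  proof -
    obtain c where c: "\<And>i. i < s \<Longrightarrow> c i \<in> \<rat>" "y = (\<Sum>j<s. c j * v j)"
      using v(2)[OF \<open>y \<in> K\<close>] by blast
    have "\<sigma>\<^sub>k i y = (\<Sum>j<s. c j * \<sigma>\<^sub>k i (v j))" for i
      unfolding c(2)
      by (subst pow_sum) (auto simp: pow_mult pow_Rats c(1) v(1) Rats_L K_L intro: L_closed(2))
    then have "(\<Sum>i<d. x i * \<sigma>\<^sub>k i y) = (\<Sum>i<d. \<Sum>j<s. c j * (x i * \<sigma>\<^sub>k i (v j)))"
      by (simp add: sum_distrib_left mult_ac)
    also have "\<dots> = (\<Sum>j<s. \<Sum>i<d. c j * (x i * \<sigma>\<^sub>k i (v j)))" by (rule sum.swap)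
    also have "\<dots> = (\<Sum>j<s. c j * (\<Sum>i<d. x i * \<sigma>\<^sub>k i (v j)))" by (simp add: sum_distrib_left)
    also have "\<dots> = 0" by (simp add: x(2))
    finally show ?thesis .
  qed
  have "x i = 0" if "i \<in> {..<d}" for i
  proof (rule dedekind_independence[of "{..<d}" K "\<lambda>i. \<sigma>\<^sub>k i" x])
    show "\<exists>y\<in>K. \<sigma>\<^sub>k i y \<noteq> \<sigma>\<^sub>k j y" if "i \<in> {..<d}" "j \<in> {..<d}" "i \<noteq> j" for i j
      using that pow_distinct[of i j] pow_distinct[of j i] by (cases "i < j") (auto simp: eq_commute)
  qed (use that zero Rats_subset_K K_closed K_L in \<open>auto simp: pow_mult pow_Rats\<close>)
  then show False using x(1) by blast
qed

section \<open>Gaussian periods and the integers of the subfield\<close>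

text \<open>The Gaussian period: the orbit sum of \<open>e i\<close> under
  \<open>\<sigma>\<^sub>k d\<close>.\<close>

definition period :: "nat \<Rightarrow> complex" where
  "period i = (\<Sum>h<n div d. e (i + d * h))"

lemma pow_period: "\<sigma>\<^sub>k k (period i) = period (i + k)"
  unfolding period_def by (subst pow_sum) (auto simp: e_L pow_e add_ac)

lemma sum_over_blocks:
  fixes f :: "nat \<Rightarrow> 'a::comm_monoid_add"
  shows "(\<Sum>j<n. f j) = (\<Sum>i<d. \<Sum>h<n div d. f (i + d * h))"
proof -
  have "(\<Sum>j<n. f j) = (\<Sum>h<n div d. sum f {h * d..<h * d + d})"
    using sum.nat_group[of f d "n div d"] d_dvd_n by simp
  also have "\<dots> = (\<Sum>h<n div d. \<Sum>i<d. f (i + d * h))"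
  proof (rule sum.cong[OF refl])
    fix h
    show "sum f {h * d..<h * d + d} = (\<Sum>i<d. f (i + d * h))"
      using sum.shift_bounds_nat_ivl[of f 0 "h * d" d]
      by (simp add: lessThan_atLeast0 mult.commute add.commute)
  qed
  also have "\<dots> = (\<Sum>i<d. \<Sum>h<n div d. f (i + d * h))" by (rule sum.swap)
  finally show ?thesis .
qed

text \<open>Combinations of periods are the combinations of the normal basis with
  \<open>d\<close>-periodic coefficients, so independence carries over.\<close>

lemma sum_period: "(\<Sum>i<d. c i * period i) = (\<Sum>j<n. c (j mod d) * e j)"
  unfolding sum_over_blocks[of "\<lambda>j. c (j mod d) * e j"] period_def
  by (intro sum.cong refl) (simp add: sum_distrib_left)

lemma period_independent:
  assumes "\<And>i. i < d \<Longrightarrow> a i \<in> \<rat>" "\<And>i. i < d \<Longrightarrow> b i \<in> \<rat>"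
    and "(\<Sum>i<d. a i * period i) = (\<Sum>i<d. b i * period i)" and "j < d"
  shows "a j = b j"
proof -
  have "j < n" using assms(4) d_dvd_n n_pos dvd_imp_le[of d n] by simp
  then have "a (j mod d) = b (j mod d)"
    using e_independent[of "\<lambda>j. a (j mod d)" "\<lambda>j. b (j mod d)" j] assms d_pos
    unfolding sum_period by simp
  then show ?thesis using assms(4) by simp
qed

text \<open>The coefficients depend only on the index modulo \<open>d\<close>, so equal ones group
  into periods.\<close>

lemma fixed_period_sum:
  assumes S: "S = \<int> \<or> S = \<rat>" and x: "x \<in> W S" "\<sigma>\<^sub>k d x = x"
  obtains c where "\<And>i. c i \<in> S" "x = (\<Sum>i<d. c i * period i)"
proof -
  obtain c where c: "\<And>i. c i \<in> S" "\<And>i. c (i + n) = c i" "x = (\<Sum>i<n. c i * e i)"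
    using x by (auto elim!: W_E)
  have per: "c (i + d) = c i" for i
    by (rule fixed_combination) (use c x S_closed(6)[OF S] in auto)
  have "c (i + d * h) = c i" for i h
  proof (induction h)
    case (Suc h)
    then show ?case using per[of "i + d * h"] by (simp add: add_ac)
  qed simp
  then have "c (j mod d) = c j" for j
    using mod_mult_div_eq[of j d] by metis
  then have "x = (\<Sum>i<d. c i * period i)"
    by (simp add: sum_period c(3))
  then show ?thesis using that c(1) by blast
qed

text \<open>The fixed field of \<open>\<sigma>\<^sub>k d\<close> contains \<open>K\<close> and has
  dimension \<open>d \<le> s\<close>, so it equals \<open>K\<close>.\<close>

lemma
  shows s_eq_d: "s = d"
    and K_eq: "K = {\<Sum>i<d. c i * period i | c. \<forall>i<d. c i \<in> \<rat>}"
proof -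
  have sub: "K \<subseteq> {\<Sum>i<d. c i * period i | c. \<forall>i<d. c i \<in> \<rat>}"
  proof
    fix x assume x: "x \<in> K"
    then have "x \<in> W \<rat>" "\<sigma>\<^sub>k d x = x"
      using K_L L_eq fixes_K_d by (auto simp: fixes_K_def)
    then obtain c where "\<And>i. c i \<in> \<rat>" "x = (\<Sum>i<d. c i * period i)"
      using fixed_period_sum[of \<rat> x] by blast
    then show "x \<in> {\<Sum>i<d. c i * period i | c. \<forall>i<d. c i \<in> \<rat>}" by blast
  qed
  have ind: "c i = 0" if "\<And>i. i < d \<Longrightarrow> c i \<in> \<rat>" "(\<Sum>i<d. c i * period i) = 0" "i < d" for c i
    using period_independent[of c "\<lambda>_. 0" i] that by simp
  show "s = d" "K = {\<Sum>i<d. c i * period i | c. \<forall>i<d. c i \<in> \<rat>}"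
    using dimension_Rats_span[of s K d period, OF dimension_K _ sub d_le_s] ind by blast+
qed

lemma period_mod: "period (i mod d) = period i"
proof -
  have "period (i + d) = period i" for i
  proof -
    have per: "e (i + d * (k + n div d)) = e (i + d * k)" for k
      using e_period[of "i + d * k"] d_dvd_n by (simp add: distrib_left add.assoc)
    show ?thesis
      unfolding period_def
      using sum_periodic_shift[of "\<lambda>k. e (i + d * k)" "n div d" 1, OF per]
      by (simp add: add.assoc)
  qed
  then have "period (i + d * q) = period i" for q i
    by (induction q) (simp_all add: add.assoc[symmetric] add.commute[of d])
  from this[of "i mod d" "i div d"] show ?thesis by simp
qed

text \<open>Invariance under \<open>\<sigma>\<^sub>k d\<close> alone does not place a period in
  \<open>K\<close>; the dimension count behind \<open>K_eq\<close> does.\<close>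

lemma period_K: "period i \<in> K"
proof -
  have "period (i mod d) = (\<Sum>j<d. (if j = i mod d then 1 else 0) * period j)"
    using d_pos by (simp add: if_distrib[of "\<lambda>x. x * _"] cong: if_cong)
  then show ?thesis
    unfolding period_mod by (subst K_eq) auto
qed

lemma ring_of_integers_eq:
  "ring_of_integers K = {\<Sum>i<d. of_int (a i) * period i | a. True}"
proof (intro subset_antisym subsetI)
  fix x assume "x \<in> ring_of_integers K"
  then have x: "x \<in> K" "x \<in> W \<int>" "\<sigma>\<^sub>k d x = x"
    using algebraic_int_in_W K_L fixes_K_d by (auto simp: ring_of_integers_def fixes_K_def)
  then obtain c where c: "\<And>i. c i \<in> \<int>" "x = (\<Sum>i<d. c i * period i)"
    using fixed_period_sum[of \<int> x] by blast
  have "\<exists>b. c i = of_int b" for i using c(1)[of i] by (auto elim: Ints_cases)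
  then obtain a where "\<And>i. c i = of_int (a i)" by metis
  then show "x \<in> {\<Sum>i<d. of_int (a i) * period i | a. True}"
    using c(2) by auto
next
  fix x assume "x \<in> {\<Sum>i<d. of_int (a i) * period i | a. True}"
  then obtain a where a: "x = (\<Sum>i<d. of_int (a i) * period i)" by blast
  have "of_int (a i) * period i \<in> K" for i
    by (intro K_closed(2) period_K) (use Rats_subset_K in auto)
  then have "x \<in> K" unfolding a by (intro sum_K)
  moreover have "x \<in> W \<int>"
    unfolding a period_def e_def by (intro W_sum W_smult W_root_pow) auto
  ultimately show "x \<in> ring_of_integers K"
    using W_imp_algebraic_int by (simp add: ring_of_integers_def)
qed

section \<open>Embeddings over the subfield, the trace of \<zeta> and coordinates\<close>

text \<open>An embedding over \<rat> is determined by the image of \<zeta>, a nontrivial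
  \<open>p\<close>-th root of unity and hence some \<open>e k\<close>. So it is an iterate of
  \<sigma>, and fixing \<open>K\<close> forces \<open>d\<close> to divide the exponent.\<close>

lemma embeddings_eq: "embeddings K L = (\<lambda>h. restrict (\<sigma>\<^sub>k (d * h)) L) ` {..<n div d}"
proof (intro subset_antisym subsetI)
  fix \<tau> assume "\<tau> \<in> (\<lambda>h. restrict (\<sigma>\<^sub>k (d * h)) L) ` {..<n div d}"
  then obtain h where \<tau>: "\<tau> = restrict (\<sigma>\<^sub>k (d * h)) L" by auto
  have "\<tau> x = x" if "x \<in> K" for x
    using fixes_K_mult[of h] that K_L by (auto simp: \<tau> fixes_K_def)
  then show "\<tau> \<in> embeddings K L"
    by (auto simp: \<tau> embeddings_def ring_hom_def pow_mult pow_add pow_Rats L_closed Rats_L)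
next
  fix \<tau> assume "\<tau> \<in> embeddings K L"
  then have ext: "\<tau> \<in> extensional L" and fix_K: "\<And>x. x \<in> K \<Longrightarrow> \<tau> x = x"
    and hom: "\<And>x y. x \<in> L \<Longrightarrow> y \<in> L \<Longrightarrow> \<tau> (x + y) = \<tau> x + \<tau> y"
      "\<And>x y. x \<in> L \<Longrightarrow> y \<in> L \<Longrightarrow> \<tau> (x * y) = \<tau> x * \<tau> y"
    by (auto simp: embeddings_def ring_hom_def)
  have Rats: "\<tau> x = x" if "x \<in> \<rat>" for x
    using fix_K that Rats_subset_K by blast
  have sum: "\<tau> (\<Sum>i\<in>A. f i) = (\<Sum>i\<in>A. \<tau> (f i))" if "\<And>i. f i \<in> L" for A :: "nat set" and f
    using that by (induction A rule: infinite_finite_induct) (auto simp: Rats hom sum_L)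
  have pow: "\<tau> (x ^ k) = \<tau> x ^ k" if "x \<in> L" for x k
    using that by (induction k) (auto simp: Rats hom power_L)
  have "\<tau> \<zeta> ^ p = 1"
    using pow[OF root_L, of p] by (simp add: root_pow_p Rats)
  \<comment> \<open>Otherwise the vanishing sum of all powers of \<zeta> would be mapped to
    \<open>p\<close>.\<close>
  moreover have "\<tau> \<zeta> \<noteq> 1"
  proof
    assume "\<tau> \<zeta> = 1"
    then have "\<tau> (\<Sum>j<p. \<zeta> ^ j) = of_nat p"
      by (subst sum) (auto simp: pow power_L root_L)
    then show False using p_gt_2 by (simp add: sum_root_pow Rats)
  qed
  \<comment> \<open>The powers of \<zeta> are \<open>p\<close> distinct \<open>p\<close>-th roots of
    unity, and there are no more than \<open>p\<close>.\<close>
  moreover have "{z. z ^ p = 1} = (\<lambda>a. \<zeta> ^ a) ` {..<p}"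
  proof (rule sym, rule card_subset_eq)
    show "finite {z::complex. z ^ p = 1}" using p_gt_2 by (intro finite_roots_unity) simp
    show "(\<lambda>a. \<zeta> ^ a) ` {..<p} \<subseteq> {z. z ^ p = 1}"
      by (auto simp: power_mult[symmetric] mult.commute[of _ p]) (simp add: power_mult root_pow_p)
    have "inj_on (\<lambda>a. \<zeta> ^ a) {..<p}"
      by (auto intro!: inj_onI simp: root_pow_eq_iff cong_def)
    then show "card ((\<lambda>a. \<zeta> ^ a) ` {..<p}) = card {z::complex. z ^ p = 1}"
      using p_gt_2 by (simp add: card_image card_roots_unity_eq)
  qed
  ultimately obtain a where a: "a < p" "\<tau> \<zeta> = \<zeta> ^ a" "a \<noteq> 0" by force
  then have "\<not> p dvd a" by (auto dest: dvd_imp_le)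
  then obtain k where k: "k < n" "\<tau> \<zeta> = e k" using root_pow_eq_e a(2) by metis
  have \<tau>: "\<tau> x = \<sigma>\<^sub>k k x" if x: "x \<in> L" for x
  proof -
    obtain c where c: "\<And>i. c i \<in> \<rat>" "x = (\<Sum>i<n. c i * e i)"
      using x by (auto simp: L_eq elim!: W_E)
    have "\<tau> (e i) = \<sigma>\<^sub>k k (e i)" for i
    proof -
      have "\<tau> (e i) = \<zeta> ^ (g ^ k * g ^ i)"
        unfolding e_def by (subst pow) (simp_all add: root_L k e_def power_mult)
      then show ?thesis by (simp add: pow_e) (simp add: e_def power_add mult.commute)
    qed
    then show ?thesis
      unfolding c(2)
      by (subst sum, simp add: c(1) L_closed(2) Rats_L e_L, subst pow_sum,
          simp add: c(1) L_closed(2) Rats_L e_L)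
        (simp add: c(1) Rats_L e_L hom pow_mult pow_Rats Rats)
  qed
  have "fixes_K k"
    using fix_K \<tau> K_L by (auto simp: fixes_K_def)
  then obtain h where h: "k = d * h" using fixes_K_imp_dvd by blast
  have "h < n div d"
    using k(1) d_dvd_n d_pos unfolding h by (metis dvd_mult_div_cancel mult_less_cancel1)
  moreover have "\<tau> = restrict (\<sigma>\<^sub>k (d * h)) L"
    using \<tau> ext unfolding h by (auto simp: extensional_def restrict_def)
  ultimately show "\<tau> \<in> (\<lambda>h. restrict (\<sigma>\<^sub>k (d * h)) L) ` {..<n div d}" by blast
qed

text \<open>Distinct \<open>h\<close> give distinct embeddings, as their values at \<zeta> show, so
  the trace is the orbit sum of \<zeta>.\<close>

lemma field_trace_root: "field_trace K L \<zeta> = period 0"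
proof -
  have inj: "inj_on (\<lambda>h. restrict (\<sigma>\<^sub>k (d * h)) L) {..<n div d}"
  proof (rule inj_onI)
    fix h h' assume h: "h \<in> {..<n div d}" "h' \<in> {..<n div d}"
      and eq: "restrict (\<sigma>\<^sub>k (d * h)) L = restrict (\<sigma>\<^sub>k (d * h')) L"
    have "e (d * h) = e (d * h')"
      using fun_cong[OF eq, of \<zeta>] pow_e[of _ 0] by (simp add: root_L e_0)
    moreover have "d * h < n" "d * h' < n"
      using h d_dvd_n d_pos by (auto simp: mult.commute less_mult_imp_div_less)
    ultimately show "h = h'" using e_inj d_pos by simp
  qed
  show ?thesis
    unfolding field_trace_def embeddings_eq sum.reindex[OF inj] period_def
    using pow_e[of _ 0] by (simp add: root_L e_0)
qed

text \<open>The restricted map may be iterated here because every period lies in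
  \<open>K\<close>.\<close>

lemma restrict_pow_period: "(restrict \<sigma> K ^^ i) (period 0) = period i"
proof (induction i)
  case (Suc i)
  then show ?case using pow_period[of 1 i] by (simp add: period_K)
qed simp

lemma from_coords_bij:
  "bij_betw (from_coords s (restrict \<sigma> K) (field_trace K L \<zeta>)) (int_vectors s) (ring_of_integers K)"
proof -
  have eq: "from_coords s (restrict \<sigma> K) (field_trace K L \<zeta>) a = (\<Sum>i<d. of_int (a i) * period i)" for a
    by (simp add: from_coords_def field_trace_root restrict_pow_period s_eq_d)
  show ?thesis
    unfolding bij_betw_def
  proof
    show "inj_on (from_coords s (restrict \<sigma> K) (field_trace K L \<zeta>)) (int_vectors s)"
    proof (rule inj_onI)
      fix a b assume a: "a \<in> int_vectors s" and b: "b \<in> int_vectors s"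
        and "from_coords s (restrict \<sigma> K) (field_trace K L \<zeta>) a =
             from_coords s (restrict \<sigma> K) (field_trace K L \<zeta>) b"
      then have "of_int (a i) = (of_int (b i) :: complex)" if "i < d" for i
        using period_independent[of "\<lambda>i. of_int (a i)" "\<lambda>i. of_int (b i)" i] that
        by (simp add: eq)
      then show "a = b"
        using a b unfolding int_vectors_def s_eq_d by (intro PiE_ext[of a]) auto
    qed
    show "from_coords s (restrict \<sigma> K) (field_trace K L \<zeta>) ` int_vectors s = ring_of_integers K"
    proof (intro subset_antisym subsetI)
      fix x assume "x \<in> ring_of_integers K"
      then obtain a where a: "x = (\<Sum>i<d. of_int (a i) * period i)"
        unfolding ring_of_integers_eq by blast
      then have "x = from_coords s (restrict \<sigma> K) (field_trace K L \<zeta>) (restrict a {..<s})"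
        unfolding eq by (simp add: s_eq_d)
      then show "x \<in> from_coords s (restrict \<sigma> K) (field_trace K L \<zeta>) ` int_vectors s"
        by (auto simp: int_vectors_def)
    qed (auto simp: eq ring_of_integers_eq)
  qed
qed

end

section \<open>Counting cosets\<close>

text \<open>The cosets of \<open>N\<close> are the fibres of \<phi> on \<open>A\<close>, and fibres
  correspond to values.\<close>

lemma additive_index_eq_card_image:
  assumes "N \<subseteq> A" and add: "\<And>x y. x \<in> A \<Longrightarrow> y \<in> A \<Longrightarrow> x + y \<in> A"
    and \<phi>: "\<And>x y. x \<in> A \<Longrightarrow> y \<in> A \<Longrightarrow> \<phi> x = \<phi> y \<longleftrightarrow> x - y \<in> N"
  shows "additive_index A N = card (\<phi> ` A)"
proof -
  let ?F = "\<lambda>v. {z \<in> A. \<phi> z = v}"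
  have coset: "N +>\<^bsub>complex_subring A\<^esub> x = ?F (\<phi> x)" if x: "x \<in> A" for x
  proof -
    have "N +>\<^bsub>complex_subring A\<^esub> x = (\<lambda>h. h + x) ` N"
      by (auto simp: a_r_coset_def')
    also have "\<dots> = ?F (\<phi> x)"
    proof (intro subset_antisym subsetI)
      fix z assume "z \<in> (\<lambda>h. h + x) ` N"
      then show "z \<in> ?F (\<phi> x)" using assms(1) add x \<phi>[of z x] by auto
    next
      fix z assume z: "z \<in> ?F (\<phi> x)"
      then have "z - x \<in> N" using \<phi>[of z x] x by simp
      then show "z \<in> (\<lambda>h. h + x) ` N" by (auto intro!: image_eqI[of _ _ "z - x"])
    qed
    finally show ?thesis .
  qed
  have "a_rcosets\<^bsub>complex_subring A\<^esub> N = ?F ` \<phi> ` A"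
    using coset by (auto simp: A_RCOSETS_def')
  moreover have "inj_on ?F (\<phi> ` A)" by (rule inj_onI) blast
  ultimately show ?thesis by (simp add: additive_index_def card_image)
qed

text \<open>The witness is the inverse discrete Fourier transform modulo \<open>p\<close>.\<close>

lemma power_interpolation_mod:
  fixes \<alpha> :: int and v :: "nat \<Rightarrow> int"
  assumes p: "Factorial_Ring.prime p" and s: "0 < s" "s < p"
    and \<alpha>: "[\<alpha> ^ s = 1] (mod int p)" "\<And>m. 0 < m \<Longrightarrow> m < s \<Longrightarrow> [\<alpha> ^ m \<noteq> 1] (mod int p)"
  obtains a :: "nat \<Rightarrow> int" where "\<And>i. i < s \<Longrightarrow> [(\<Sum>j<s. a j * \<alpha> ^ (j * i)) = v i] (mod int p)"
proof -
  have "\<not> p dvd s" using s by (auto dest: dvd_imp_le)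
  then have "coprime (int s) (int p)"
    using p prime_imp_coprime_nat[of p s] by (simp add: coprime_commute)
  then obtain r where r: "[int s * r = 1] (mod int p)"
    using cong_solve_coprime_int by blast
  \<comment> \<open>Modulo \<open>p\<close> the exponent \<open>s - l\<close> acts as
    \<open>- l\<close>, and \<open>r\<close> inverts \<open>s\<close>, the normalising factor of the
    transform.\<close>
  define a where "a j = r * (\<Sum>l<s. v l * \<alpha> ^ (j * (s - l)))" for j
  \<comment> \<open>Orthogonality: for \<open>i \<noteq> l\<close> the geometric sum times
    \<open>?b - 1\<close> is \<open>?b ^ s - 1\<close>, divisible by \<open>p\<close>, while
    \<open>?b - 1\<close> is not.\<close>
  have geo: "[(\<Sum>j<s. (\<alpha> ^ (s - l + i)) ^ j) = (if i = l then int s else 0)] (mod int p)"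
    if i: "i < s" and l: "l < s" for i l
  proof (cases "i = l")
    case True
    then have "s - l + i = s" using i by simp
    moreover have "[(\<Sum>j<s. (\<alpha> ^ s) ^ j) = (\<Sum>j<s. 1 ^ j)] (mod int p)"
      by (intro cong_sum cong_pow \<alpha>(1))
    ultimately show ?thesis using True by simp
  next
    case False
    let ?b = "\<alpha> ^ (s - l + i)"
    have "?b ^ s = (\<alpha> ^ s) ^ (s - l + i)"
      by (metis power_mult mult.commute)
    moreover have "[\<dots> = 1 ^ (s - l + i)] (mod int p)"
      by (intro cong_pow \<alpha>(1))
    ultimately have "[?b ^ s = 1 ^ (s - l + i)] (mod int p)" by simp
    then have "int p dvd ?b ^ s - 1" by (simp add: cong_iff_dvd_diff)
    also have "?b ^ s - 1 = (?b - 1) * (\<Sum>j<s. ?b ^ j)"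
      by (rule power_diff_1_eq)
    finally have dvd: "int p dvd (?b - 1) * (\<Sum>j<s. ?b ^ j)" .
    \<comment> \<open>Modulo \<open>s\<close> the exponent is \<open>i - l\<close>, which is nonzero
      for distinct \<open>i\<close> and \<open>l\<close> below \<open>s\<close>.\<close>
    have "[?b \<noteq> 1] (mod int p)"
    proof (cases "i < l")
      case True
      then show ?thesis using i l by (intro \<alpha>(2)) auto
    next
      case ge: False
      then have "s - l + i = s + (i - l)" using l by simp
      then have "?b = \<alpha> ^ s * \<alpha> ^ (i - l)" by (simp only: power_add)
      moreover have "[\<dots> = 1 * \<alpha> ^ (i - l)] (mod int p)"
        by (intro cong_mult \<alpha>(1) cong_refl)
      ultimately have "[?b = 1 * \<alpha> ^ (i - l)] (mod int p)" by simp
      moreover have "[\<alpha> ^ (i - l) \<noteq> 1] (mod int p)"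
        using ge False i by (intro \<alpha>(2)) auto
      ultimately show ?thesis by (metis cong_sym cong_trans mult_1)
    qed
    then have "\<not> int p dvd ?b - 1" by (simp add: cong_iff_dvd_diff)
    then have "int p dvd (\<Sum>j<s. ?b ^ j)"
      using dvd p by (simp add: prime_dvd_mult_iff)
    then show ?thesis using False by (simp add: cong_0_iff)
  qed
  show ?thesis
  proof (rule that)
    fix i assume i: "i < s"
    have "(\<Sum>j<s. a j * \<alpha> ^ (j * i)) =
        (\<Sum>j<s. \<Sum>l<s. r * v l * (\<alpha> ^ (s - l + i)) ^ j)"
    proof -
      have "(\<alpha> ^ (s - l + i)) ^ j = \<alpha> ^ (j * (s - l)) * \<alpha> ^ (j * i)" for j l
        by (simp only: power_mult[symmetric] power_add[symmetric] distrib_left mult.commute add.commute)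
      then show ?thesis
        unfolding a_def by (simp only: sum_distrib_left sum_distrib_right mult.assoc)
    qed
    also have "\<dots> = (\<Sum>l<s. r * v l * (\<Sum>j<s. (\<alpha> ^ (s - l + i)) ^ j))"
      by (subst sum.swap) (simp add: sum_distrib_left)
    also have "[\<dots> = (\<Sum>l<s. r * v l * (if i = l then int s else 0))] (mod int p)"
      using i by (intro cong_sum cong_mult cong_refl geo) auto
    also have "(\<Sum>l<s. r * v l * (if i = l then int s else 0)) = v i * (int s * r)"
      using i by (simp add: if_distrib[of "(*) _"] cong: if_cong)
    also have "[v i * (int s * r) = v i * 1] (mod int p)"
      by (intro cong_mult cong_refl r)
    finally show "[(\<Sum>j<s. a j * \<alpha> ^ (j * i)) = v i] (mod int p)" by simp
  qed
qed

text \<open>Adding a multiple of \<open>p\<close> to one coordinate preserves all residues modulo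
  \<open>p\<close>; as \<open>p\<close> is odd, it can still set the parity of the sum.\<close>

lemma power_interpolation_mod_parity:
  fixes \<alpha> :: int and v :: "nat \<Rightarrow> int" and b :: int
  assumes p: "Factorial_Ring.prime p" "odd p" and s: "0 < s" "s < p"
    and \<alpha>: "[\<alpha> ^ s = 1] (mod int p)" "\<And>m. 0 < m \<Longrightarrow> m < s \<Longrightarrow> [\<alpha> ^ m \<noteq> 1] (mod int p)"
  obtains a :: "nat \<Rightarrow> int" where "\<And>i. i < s \<Longrightarrow> [(\<Sum>j<s. a j * \<alpha> ^ (j * i)) = v i] (mod int p)"
    "[(\<Sum>j<s. a j) = b] (mod 2)"
proof -
  obtain a where a: "\<And>i. i < s \<Longrightarrow> [(\<Sum>j<s. a j * \<alpha> ^ (j * i)) = v i] (mod int p)"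
    using power_interpolation_mod[OF p(1) s \<alpha>] by blast
  define c where "c = b - (\<Sum>j<s. a j)"
  define a' where "a' = a(0 := a 0 + int p * c)"
  have sum: "(\<Sum>j<s. a' j * f j) = (\<Sum>j<s. a j * f j) + int p * c * f 0" for f
  proof -
    have "a' j * f j = a j * f j + (if j = 0 then int p * c * f 0 else 0)" for j
      by (simp add: a'_def algebra_simps)
    then show ?thesis using s(1) by (simp add: sum.distrib)
  qed
  show ?thesis
  proof (rule that[of a'])
    fix i assume "i < s"
    have "[(\<Sum>j<s. a j * \<alpha> ^ (j * i)) + int p * c * \<alpha> ^ (0 * i) = v i + 0] (mod int p)"
      by (intro cong_add a \<open>i < s\<close>) (simp add: cong_0_iff)
    then show "[(\<Sum>j<s. a' j * \<alpha> ^ (j * i)) = v i] (mod int p)"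
      unfolding sum by simp
  next
    \<comment> \<open>The new sum is \<open>b - c + p * c\<close>, and \<open>p - 1\<close> is
      even.\<close>
    have "(\<Sum>j<s. a' j) - b = (int p - 1) * c"
      using sum[of "\<lambda>_. 1"] by (simp add: c_def algebra_simps)
    moreover have "2 dvd int p - 1" using p(2) by simp
    ultimately show "[(\<Sum>j<s. a' j) = b] (mod 2)"
      by (simp add: cong_iff_dvd_diff)
  qed
qed

text \<open>The base has order \<open>p - 1\<close>, so its power with exponent
  \<open>(p - 1) div s\<close> has order \<open>s\<close>.\<close>

lemma residue_primroot_power_order:
  fixes \<beta> :: int
  assumes p: "Factorial_Ring.prime p" and s: "0 < s" "s dvd p - 1"
    and \<beta>: "residue_primroot p (nat (\<beta> mod int p))"
  defines "\<alpha> \<equiv> \<beta> ^ ((p - 1) div s)"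
  shows "[\<alpha> ^ m = 1] (mod int p) \<longleftrightarrow> s dvd m"
proof -
  define b where "b = nat (\<beta> mod int p)"
  have p0: "p > 1" using p prime_gt_1_nat by blast
  have "[\<beta> = int b] (mod int p)" using p0 by (simp add: b_def cong_def)
  then have "[\<alpha> ^ m = int b ^ ((p - 1) div s * m)] (mod int p)"
    unfolding \<alpha>_def power_mult by (intro cong_pow)
  then have "[\<alpha> ^ m = 1] (mod int p) \<longleftrightarrow> [int b ^ ((p - 1) div s * m) = 1] (mod int p)"
    by (meson cong_sym cong_trans)
  also have "\<dots> \<longleftrightarrow> [b ^ ((p - 1) div s * m) = 1] (mod p)"
    by (metis cong_int_iff of_nat_1 of_nat_power)
  also have "\<dots> \<longleftrightarrow> ord p b dvd (p - 1) div s * m"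
    by (rule ord_divides)
  also have "ord p b = (p - 1) div s * s"
    using \<beta> s p by (simp add: residue_primroot_def b_def totient_prime)
  also have "(p - 1) div s * s dvd (p - 1) div s * m \<longleftrightarrow> s dvd m"
  proof (rule nat_mult_dvd_cancel1)
    show "0 < (p - 1) div s" using s p0 by (metis div_greater_zero_iff dvd_imp_le zero_less_diff)
  qed
  finally show ?thesis .
qed

section \<open>The index formula\<close>

lemma from_coords_add:
  "from_coords s \<theta> t (restrict (\<lambda>i. a i + b i) {..<s}) = from_coords s \<theta> t a + from_coords s \<theta> t b"
  by (simp add: from_coords_def sum.distrib distrib_right)

lemma from_coords_diff:
  "from_coords s \<theta> t (restrict (\<lambda>i. a i - b i) {..<s}) = from_coords s \<theta> t a - from_coords s \<theta> t b"
  by (simp add: from_coords_def sum_subtractf left_diff_distrib)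

text \<open>\<phi> records the \<open>k\<close> dot products modulo \<open>p\<close> and the parity
  of the coordinate sum. Its fibres are the cosets of the module, and by interpolation it attains
  all \<open>2 * p ^ k\<close> conceivable values.\<close>

lemma additive_index_M_tilde:
  assumes bij: "bij_betw (from_coords s \<theta> t) (int_vectors s) (ring_of_integers K)"
    and p: "Factorial_Ring.prime p" "odd p" and s: "0 < s" "s < p"
    and \<alpha>: "[\<alpha> ^ s = 1] (mod int p)" "\<And>m. 0 < m \<Longrightarrow> m < s \<Longrightarrow> [\<alpha> ^ m \<noteq> 1] (mod int p)"
  shows "additive_index (ring_of_integers K) (M_tilde p s K \<theta> t \<alpha>) =
      2 * p ^ Suc (if odd s then (s - 1) div 2 else s div 2)"
proof -
  define k where "k = Suc (if odd s then (s - 1) div 2 else s div 2)"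
  \<comment> \<open>Interpolation reaches only indices below \<open>s\<close>. For even
    \<open>s\<close> the bound holds because a positive even \<open>s\<close> is at least 2.\<close>
  have k: "k \<le> s" using s(1) unfolding k_def by (auto elim!: oddE evenE)
  let ?A = "ring_of_integers K" and ?f = "from_coords s \<theta> t" and ?c = "coords s \<theta> t"
  define dot where "dot a i = int_dot s a (mu_vec \<alpha> i)" for a i
  define \<phi> where "\<phi> x = (\<lambda>i\<in>{..<k}. dot (?c x) i mod int p, (\<Sum>i<s. ?c x i) mod 2)" for x
  have c_f: "?c (?f a) = a" if "a \<in> int_vectors s" for a
    unfolding coords_def using bij that by (intro the_inv_into_f_f) (auto simp: bij_betw_def)
  have c_mem: "?c x \<in> int_vectors s" and f_c: "?f (?c x) = x" if "x \<in> ?A" for x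
    using that bij_betwE[OF bij_betw_the_inv_into[OF bij]] f_the_inv_into_f_bij_betw[OF bij]
    unfolding coords_def by auto
  have f_mem: "?f a \<in> ?A" if "a \<in> int_vectors s" for a
    using bij that by (auto simp: bij_betw_def)
  have add: "x + y \<in> ?A" if "x \<in> ?A" "y \<in> ?A" for x y
    using f_mem[of "restrict (\<lambda>i. ?c x i + ?c y i) {..<s}"] that
    by (simp add: from_coords_add f_c int_vectors_def)
  have diff: "x - y \<in> ?A" "?c (x - y) = restrict (\<lambda>i. ?c x i - ?c y i) {..<s}"
    if "x \<in> ?A" "y \<in> ?A" for x y
    using f_mem[of "restrict (\<lambda>i. ?c x i - ?c y i) {..<s}"]
      c_f[of "restrict (\<lambda>i. ?c x i - ?c y i) {..<s}"] that
    by (simp_all add: from_coords_diff f_c int_vectors_def)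
  have range: "{0..(if odd s then (s - 1) div 2 else s div 2)} = {..<k}"
    by (auto simp: k_def)
  have mem: "x \<in> M_tilde p s K \<theta> t \<alpha> \<longleftrightarrow>
      x \<in> ?A \<and> (\<forall>i<k. int p dvd dot (?c x) i) \<and> 2 dvd (\<Sum>i<s. ?c x i)" for x
    unfolding M_tilde_def M_module_def range by (auto simp: dot_def cong_0_iff)
  have "additive_index ?A (M_tilde p s K \<theta> t \<alpha>) = card (\<phi> ` ?A)"
  proof (rule additive_index_eq_card_image)
    fix x y assume xy: "x \<in> ?A" "y \<in> ?A"
    have "dot (?c (x - y)) i = dot (?c x) i - dot (?c y) i" for i
      by (simp add: diff(2)[OF xy] dot_def int_dot_def left_diff_distrib sum_subtractf)
    moreover have "(\<Sum>i<s. ?c (x - y) i) = (\<Sum>i<s. ?c x i) - (\<Sum>i<s. ?c y i)"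
      by (simp add: diff(2)[OF xy] sum_subtractf)
    ultimately show "\<phi> x = \<phi> y \<longleftrightarrow> x - y \<in> M_tilde p s K \<theta> t \<alpha>"
      using diff(1)[OF xy]
      by (auto simp: \<phi>_def mem mod_eq_dvd_iff fun_eq_iff restrict_def)
  qed (use add mem in auto)
  also have "\<phi> ` ?A = ({..<k} \<rightarrow>\<^sub>E {0..<int p}) \<times> {0..<2}" (is "_ = ?B")
  proof (intro subset_antisym subsetI)
    fix y assume "y \<in> \<phi> ` ?A"
    then show "y \<in> ?B" using s by (auto simp: \<phi>_def)
  next
    fix y assume "y \<in> ?B"
    then obtain v b where y: "y = (v, b)" "v \<in> {..<k} \<rightarrow>\<^sub>E {0..<int p}" "b \<in> {0..<2}" by auto
    obtain a where a: "\<And>i. i < s \<Longrightarrow> [(\<Sum>j<s. a j * \<alpha> ^ (j * i)) = v i] (mod int p)"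
      "[(\<Sum>j<s. a j) = b] (mod 2)"
      using power_interpolation_mod_parity[OF p s \<alpha>] by blast
    let ?a = "restrict a {..<s}"
    have mem: "?a \<in> int_vectors s" by (simp add: int_vectors_def)
    have "dot ?a i mod int p = v i" if "i < k" for i
    proof -
      have "dot ?a i = (\<Sum>j<s. a j * \<alpha> ^ (j * i))"
        by (simp add: dot_def int_dot_def mu_vec_def)
      then have "dot ?a i mod int p = v i mod int p"
        using a(1)[of i] that k by (simp add: cong_def)
      also have "\<dots> = v i" using y(2) that by (intro mod_pos_pos_trivial) (auto simp: PiE_iff)
      finally show ?thesis .
    qed
    then have "(\<lambda>i\<in>{..<k}. dot ?a i mod int p) = v"
      using y(2) by (intro ext) (auto simp: restrict_def PiE_iff extensional_def)
    moreover have "(\<Sum>i<s. ?a i) mod 2 = b"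
      using a(2) y(3) by (simp add: cong_def)
    ultimately have "\<phi> (?f ?a) = y"
      by (simp add: \<phi>_def c_f[OF mem] y(1))
    then show "y \<in> \<phi> ` ?A" using f_mem[OF mem] by blast
  qed
  also have "card ?B = 2 * p ^ k"
    by (simp add: card_cartesian_product card_PiE)
  finally show ?thesis by (simp add: k_def)
qed

text \<open>Oddness of \<open>p\<close> is essential: for \<open>p = 2\<close> and
  \<open>s = 1\<close> the parity condition coincides with the congruence at \<open>i = 0\<close>,
  and the index would be 2 instead of 4.\<close>

theorem corollary18:
  fixes p s :: nat and \<zeta> t :: complex and L K :: "complex set"
    and u \<beta> \<alpha> :: int and \<sigma> \<theta> :: "complex \<Rightarrow> complex"
  assumes "Factorial_Ring.prime p" and "odd p" and "0 < s" and "s dvd p - 1"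
    and "primitive_root_of_unity p \<zeta>"
  defines "L \<equiv> rat_adjoin \<zeta>"
  assumes "subfield K complex_ring" and "K \<subseteq> L" and "ring.dimension complex_ring s \<rat> K"
    and "generates_units_mod p u"
    and "\<sigma> \<in> ring_iso (complex_subring L) (complex_subring L)" and "\<sigma> \<zeta> = \<zeta> powi u"
  defines "\<theta> \<equiv> restrict \<sigma> K" and "t \<equiv> field_trace K L \<zeta>"
  assumes "residue_primroot p (nat (\<beta> mod int p))"
  defines "\<alpha> \<equiv> \<beta> ^ ((p - 1) div s)"
  shows "additive_index (ring_of_integers K) (M_tilde p s K \<theta> t \<alpha>) =
           (if odd s then 2 * p ^ ((s + 1) div 2) else 2 * p ^ ((s + 2) div 2))"
proof -
  obtain g where g: "[u = int g] (mod int p)" "\<And>a. \<not> p dvd a \<Longrightarrow> \<exists>i. [g ^ i = a] (mod p)"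
    using generates_units_modD[OF assms(1,10)] by blast
  have root_p: "\<zeta> ^ p = 1" using assms(5) by (simp add: primitive_root_of_unity_def)
  have p: "p > 1" using assms(1) prime_gt_1_nat by blast
  then have "\<zeta> \<noteq> 0" using root_p by (auto simp: power_0_left)
  \<comment> \<open>\<open>u\<close> may be negative, so the integer power is reduced to exponent
    \<open>g\<close> by splitting off a multiple of \<open>p\<close>.\<close>
  obtain q where q: "u = int g + int p * q"
    using g(1) by (metis cong_iff_lin cong_sym)
  have "\<zeta> powi u = \<zeta> ^ g"
    using \<open>\<zeta> \<noteq> 0\<close> by (simp add: q power_int_add power_int_mult root_p)
  then have \<sigma>_root: "\<sigma> \<zeta> = \<zeta> ^ g" using assms(12) by simp
  have "cyclotomic_automorphism p g \<zeta> \<sigma>"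
    using assms(11) \<sigma>_root assms(1,2,5) g(2)
    by unfold_locales (auto simp: L_def ring_iso_def ring_hom_def bij_betw_def)
  then interpret cyclotomic_subfield p g \<zeta> \<sigma> L K s
    unfolding L_def using assms(7,8,9)
    by (intro cyclotomic_subfield.intro cyclotomic_subfield_axioms.intro) (auto simp: L_def)
  have "s < p" using assms(4) p by (auto dest: dvd_imp_le)
  note order = residue_primroot_power_order[OF assms(1,3,4,15), folded \<alpha>_def]
  have "additive_index (ring_of_integers K) (M_tilde p s K \<theta> t \<alpha>) =
      2 * p ^ Suc (if odd s then (s - 1) div 2 else s div 2)"
    using from_coords_bij assms(1,2,3) \<open>s < p\<close>
    unfolding \<theta>_def t_def
    by (intro additive_index_M_tilde) (auto simp: order dest: dvd_imp_le)
  also have "\<dots> = (if odd s then 2 * p ^ ((s + 1) div 2) else 2 * p ^ ((s + 2) div 2))"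
    using assms(3) by (auto elim!: oddE evenE)
  finally show ?thesis .
qed

end
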